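(* Let $\mathcal{D}$ be a bounded domain in a complex Banach space $X$ equipped with a hyperbolic metric. Let $\mathcal{F}=\{F_t\}_{t\ge0}$ be a semigroup of holomorphic self-mappings of $\mathcal{D}$ satisfying condition ( * ) below with limit point $x_0$, and let $\{\Gamma_t\}_{t\ge0}$ be a $T$-continuous semicocycle over $\mathcal{F}$ with values in a complex unital Banach algebra $\mathcal{A}$, generated by a holomorphic $B:\mathcal{D}\to\mathcal{A}$, with $B_0=B(x_0)$. If $$\lim_{x\to x_0}\frac{\|B(x)-B_0\|_{\mathcal A}}{\|x-x_0\|_X^{\ell}}=0,\qquad \ell:=\frac{\kappa_+(B_0)-\kappa_-(B_0)}{|\kappa_+(A)|},\ A=f'(x_0),$$ then the limit $M(x)=\lim_{t\to\infty}e^{-tB_0}\Gamma_t(x)$ exists and defines a holomorphic $M:\mathcal{D}\to\mathcal{A}_*$ with $\Gamma_t(x)=M(F_t(x))^{-1}e^{tB_0}M(x)$ for all $t\ge0$, $x\in\mathcal{D}$.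
   Context: Condition ( * ): $F_t(x)\to x_0\in\mathcal{D}$ as $t\to\infty$ uniformly on subsets strictly inside $\mathcal{D}$, and $\mathcal{F}$ is generated by a holomorphic $f:\mathcal{D}\to X$ (i.e. $f(x)=\lim_{t\to0^+}\frac1t(F_t(x)-x)$, uniformly on subsets strictly inside $\mathcal{D}$) such that $\kappa_+(A)<0$ for $A=f'(x_0)\in L(X)$. For an element $a$ of a Banach algebra, $\kappa_+(a)=\limsup_{t\to\infty}\frac1t\log\|e^{ta}\|$ and $\kappa_-(a)=-\limsup_{t\to\infty}\frac1t\log\|e^{-ta}\|$ (for $A$, in $L(X)$ with operator norm). A subset lies strictly inside $\mathcal{D}$ if bounded and at positive distance from $\partial\mathcal{D}$. A semigroup: holomorphic self-maps $F_t$ of $\mathcal{D}$ with $F_{t+s}=F_t\circ F_s$, $F_t(x)\to x$ as $t\to0^+$. $\mathcal{A}$ has unit $1_{\mathcal A}$, $\|1_{\mathcal A}\|=1$; $\mathcal{A}_*$ = invertible elements. A semicocycle over $\mathcal{F}$: holomorphic $\Gamma_t:\mathcal{D}\to\mathcal{A}$ with $\Gamma_t(F_s(x))\Gamma_s(x)=\Gamma_{t+s}(x)$, $\Gamma_t(x)\to1_{\mathcal A}$ as $t\to0^+$; it is $T$-continuous if $\Gamma_t\to\Gamma_{t_0}$ as $t\to t_0$ uniformly on each subset strictly inside $\mathcal{D}$, for every $t_0\ge0$; it is generated by $B$ if $t\mapsto\Gamma_t(x)$ solves $\frac{dv}{dt}=B(F_t(x))v$, $v(0)=1_{\mathcal A}$.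 A hyperbolic metric on $\mathcal{D}$ is a metric $\rho$ for which holomorphic self-maps are $\rho$-nonexpansive and a set lies strictly inside $\mathcal{D}$ iff it lies in a $\rho$-ball of finite radius. *)

theory Defs
  imports "HOL-Analysis.Analysis"
begin

class complex_normed_vector = real_normed_vector +
  fixes scaleC :: "complex \<Rightarrow> 'a \<Rightarrow> 'a" (infixr "*\<^sub>C" 75)
  assumes scaleC_add_right: "a *\<^sub>C (x + y) = a *\<^sub>C x + a *\<^sub>C y"
    and scaleC_add_left: "(a + b) *\<^sub>C x = a *\<^sub>C x + b *\<^sub>C x"
    and scaleC_scaleC: "a *\<^sub>C (b *\<^sub>C x) = (a * b) *\<^sub>C x"
    and scaleC_one: "1 *\<^sub>C x = x"
    and scaleR_scaleC: "r *\<^sub>R x = complex_of_real r *\<^sub>C x"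
    and norm_scaleC: "norm (a *\<^sub>C x) = cmod a * norm x"

class complex_normed_algebra_1 = complex_normed_vector + real_normed_algebra_1 +
  assumes scaleC_left_commute: "(a *\<^sub>C x) * y = a *\<^sub>C (x * y)"
    and scaleC_right_commute: "x * (a *\<^sub>C y) = a *\<^sub>C (x * y)"

instantiation complex :: complex_normed_algebra_1
begin
definition scaleC_complex :: "complex \<Rightarrow> complex \<Rightarrow> complex" where
  "scaleC_complex a x = a * x"
instance
  by standard (auto simp: scaleC_complex_def algebra_simps norm_mult scaleR_conv_of_real)
end

definition holo_on :: "'a::complex_normed_vector set \<Rightarrow> ('a \<Rightarrow> 'b::complex_normed_vector) \<Rightarrow> bool" where
  "holo_on D f \<longleftrightarrow> (\<forall>x\<in>D. \<exists>L. (f has_derivative L) (at x) \<and> (\<forall>c v. L (c *\<^sub>C v) = c *\<^sub>C L v))"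

definition strictly_inside :: "'a::real_normed_vector set \<Rightarrow> 'a set \<Rightarrow> bool" where
  "strictly_inside D S \<longleftrightarrow> S \<subseteq> D \<and> bounded S \<and>
     (\<exists>\<epsilon>>0. \<forall>x\<in>S. \<forall>y\<in>frontier D. \<epsilon> \<le> dist x y)"

definition hyperbolic_metric :: "'a::complex_normed_vector set \<Rightarrow> ('a \<Rightarrow> 'a \<Rightarrow> real) \<Rightarrow> bool" where
  "hyperbolic_metric D \<rho> \<longleftrightarrow>
     (\<forall>x\<in>D. \<forall>y\<in>D. 0 \<le> \<rho> x y \<and> (\<rho> x y = 0 \<longleftrightarrow> x = y) \<and> \<rho> x y = \<rho> y x) \<and>
     (\<forall>x\<in>D. \<forall>y\<in>D. \<forall>z\<in>D. \<rho> x z \<le> \<rho> x y + \<rho> y z) \<and>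
     (\<forall>g. holo_on D g \<and> g ` D \<subseteq> D \<longrightarrow> (\<forall>x\<in>D. \<forall>y\<in>D. \<rho> (g x) (g y) \<le> \<rho> x y)) \<and>
     (\<forall>S. S \<subseteq> D \<longrightarrow> (strictly_inside D S \<longleftrightarrow> (\<exists>c\<in>D. \<exists>r. \<forall>y\<in>S. \<rho> c y \<le> r)))"

definition kappa_plus :: "'b::{real_normed_algebra_1,banach} \<Rightarrow> real" where
  "kappa_plus a = real_of_ereal (Limsup at_top (\<lambda>t::real. ereal (ln (norm (exp (t *\<^sub>R a))) / t)))"

definition kappa_minus :: "'b::{real_normed_algebra_1,banach} \<Rightarrow> real" where
  "kappa_minus a = - real_of_ereal (Limsup at_top (\<lambda>t::real. ereal (ln (norm (exp (- (t *\<^sub>R a)))) / t)))"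

definition op_pow :: "('a::real_normed_vector \<Rightarrow>\<^sub>L 'a) \<Rightarrow> nat \<Rightarrow> ('a \<Rightarrow>\<^sub>L 'a)" where
  "op_pow A n = ((\<lambda>B. A o\<^sub>L B) ^^ n) id_blinfun"

definition op_exp :: "real \<Rightarrow> ('a::real_normed_vector \<Rightarrow>\<^sub>L 'a) \<Rightarrow> ('a \<Rightarrow>\<^sub>L 'a)" where
  "op_exp t A = (\<Sum>n. (t ^ n / fact n) *\<^sub>R op_pow A n)"

definition kappa_plus_op :: "('a::real_normed_vector \<Rightarrow>\<^sub>L 'a) \<Rightarrow> real" where
  "kappa_plus_op A = real_of_ereal (Limsup at_top (\<lambda>t::real. ereal (ln (norm (op_exp t A)) / t)))"

end

theory Submission
  imports Defs "HOL-Complex_Analysis.Complex_Analysis"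
begin

text \<open>
  Put \<open>Y\<^sub>t(x) = e\<^bsup>-tB\<^sub>0\<^esup> \<Gamma>\<^sub>t(x)\<close>, so that \<open>Y' = K Y\<close> with
  \<open>K\<^sub>t(x) = e\<^bsup>-tB\<^sub>0\<^esup> (B(F\<^sub>t x) - B\<^sub>0) e\<^bsup>tB\<^sub>0\<^esup>\<close>. The growth bounds for \<open>e\<^bsup>tB\<^sub>0\<^esup>\<close>, \<open>e\<^bsup>-tB\<^sub>0\<^esup>\<close> and for
  \<open>F\<^sub>t x - x\<^sub>0\<close> only just fail to make \<open>K\<close> integrable when \<open>B - B\<^sub>0 = o(\<parallel>x - x\<^sub>0\<parallel>\<^sup>\<ell>)\<close>. Since \<open>B\<close> is
  holomorphic, however, \<open>B - B\<^sub>0 = O(\<parallel>x - x\<^sub>0\<parallel>\<^sup>m)\<close> for the least integer \<open>m > \<ell>\<close>, and then \<open>K\<close> decays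
  exponentially, uniformly on sets strictly inside \<open>D\<close>. Hence \<open>Y\<^sub>t\<close> converges locally uniformly
  to a holomorphic \<open>M\<close>. Passing to the limit in the cocycle identity gives
  \<open>M(x) = e\<^bsup>-tB\<^sub>0\<^esup> M(F\<^sub>t x) \<Gamma>\<^sub>t(x)\<close>; for large \<open>t\<close> all three factors are invertible, the middle one
  because \<open>M(x\<^sub>0) = 1\<close>.
\<close>

section \<open>Complex norming functionals\<close>

text \<open>The obstacle is uniformity in time: each estimate must hold along whole orbits with one
  set of constants. Two devices supply this. Hyperbolic balls about \<open>x0\<close> lie strictly
  inside \<open>D\<close> and are mapped into themselves by every \<open>F t\<close>, because
  \<open>x0\<close> is fixed and holomorphic self-maps do not expand \<open>\<rho>\<close>. And
  since \<open>D\<close> is bounded, Schwarz' lemma gives all \<open>F t\<close> a common Lipschitz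
  constant at \<open>x0\<close>. The assumption on \<open>A\<close> speaks only of the linear flow;
  it reaches \<open>F\<close> by comparing \<open>F T\<close> with \<open>op_exp T A\<close> at a
  single large time \<open>T\<close> and iterating the contraction so obtained. The definition of
  \<open>ell\<close> says that \<open>ell * \<bar>kappa_plus_op A\<bar>\<close> is exactly
  \<open>kappa_plus B0 - kappa_minus B0\<close>; replacing \<open>ell\<close> by a larger integer
  leaves a positive gap, and this gap absorbs the epsilons lost in the three growth bounds. Norming
  functionals reduce Schwarz' lemma for Banach-valued maps to the scalar lemma with the same
  constants.\<close>

definition sublinear :: "('a::real_vector \<Rightarrow> real) \<Rightarrow> bool" where
  "sublinear p \<longleftrightarrow> (\<forall>x y. p (x + y) \<le> p x + p y) \<and> (\<forall>t\<ge>0. \<forall>x. p (t *\<^sub>R x) = t * p x)"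

text \<open>One inequality for positive scalars is enough: applied to \<open>inverse t\<close> and
  \<open>t *\<^sub>R x\<close> it yields the reverse one.\<close>

lemma sublinearI:
  assumes add: "\<And>x y. p (x + y) \<le> p x + p y" and zero: "p 0 = 0"
    and scale: "\<And>t x. t > 0 \<Longrightarrow> p (t *\<^sub>R x) \<le> t * p x"
  shows "sublinear p"
  unfolding sublinear_def
proof (intro conjI allI impI)
  fix t :: real and x assume "t \<ge> 0"
  show "p (t *\<^sub>R x) = t * p x"
  proof (cases "t = 0")
    case False
    then have t: "t > 0" using \<open>t \<ge> 0\<close> by simp
    have "p x \<le> inverse t * p (t *\<^sub>R x)"
      using scale[of "inverse t" "t *\<^sub>R x"] t by simp
    then have "t * p x \<le> p (t *\<^sub>R x)" using t by (simp add: field_simps)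
    with scale[OF t, of x] show ?thesis by simp
  qed (simp add: zero)
qed (rule add)

lemma sublinear_zero: "sublinear p \<Longrightarrow> p 0 = 0"
  unfolding sublinear_def by (metis mult_zero_left order_refl scaleR_zero_left)

lemma sublinear_minus:
  assumes "sublinear p" shows "- p (- x) \<le> p x"
proof -
  have "p (x + (- x)) \<le> p x + p (- x)" using assms unfolding sublinear_def by blast
  then show ?thesis using sublinear_zero[OF assms] by simp
qed

text \<open>By this shift a minimal sublinear functional is additive, so Hahn-Banach follows
  from Zorn's lemma.\<close>

lemma sublinear_shift:
  assumes q: "sublinear q"
  obtains r where "sublinear r" "\<And>x. r x \<le> q x" "\<And>x. r x \<le> q (x + y) - q y"
proof -
  have add: "q (a + b) \<le> q a + q b" and hom: "t \<ge> 0 \<Longrightarrow> q (t *\<^sub>R a) = t * q a" for a b t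
    using q by (auto simp: sublinear_def)
  \<comment> \<open>A linear \<open>u\<close> below \<open>q\<close> with \<open>u y = q y\<close>
    would satisfy \<open>u x = u (x + t *\<^sub>R y) - t * q y\<close>, hence be at most
    \<open>g x t\<close>. The infimum over \<open>t\<close> collects all these constraints;
    \<open>t = 0\<close> and \<open>t = 1\<close> give the two required bounds.\<close>
  define g where "g x t = q (x + t *\<^sub>R y) - t * q y" for x t
  define r where "r x = (INF t\<in>{0..}. g x t)" for x
  have lower: "- q (- x) \<le> g x t" if "t \<ge> 0" for x t
    using add[of "x + t *\<^sub>R y" "- x"] hom[OF that, of y] by (simp add: g_def)
  have bdd: "bdd_below (g x ` {0..})" for x
    by (rule bdd_belowI[of _ "- q (- x)"]) (auto intro: lower)
  have upper: "r x \<le> g x t" if "t \<ge> 0" for x t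
    unfolding r_def using that by (intro cINF_lower bdd) auto
  have "r (x + z) \<le> r x + r z" for x z
  proof -
    have *: "r (x + z) - g z s \<le> g x t" if "t \<ge> 0" "s \<ge> 0" for t s
      using upper[of "t + s" "x + z"] that add[of "x + t *\<^sub>R y" "z + s *\<^sub>R y"]
      by (simp add: g_def algebra_simps)
    have "r (x + z) - g z s \<le> r x" if "s \<ge> 0" for s
      unfolding r_def[of x] by (rule cINF_greatest) (use * that in auto)
    then have "r (x + z) - r x \<le> g z s" if "s \<ge> 0" for s using that by (smt (verit))
    then have "r (x + z) - r x \<le> r z"
      unfolding r_def[of z] by (intro cINF_greatest) auto
    then show ?thesis by simp
  qed
  moreover have "r 0 = 0"
  proof -
    have "g 0 t = 0" if "t \<ge> 0" for t using hom[OF that] by (simp add: g_def)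
    then have "r 0 = (INF t\<in>{0::real..}. 0)" unfolding r_def by (intro INF_cong) auto
    then show ?thesis by simp
  qed
  moreover have "r (c *\<^sub>R x) \<le> c * r x" if "c > 0" for c x
  proof -
    have "inverse c * r (c *\<^sub>R x) \<le> g x t" if "t \<ge> 0" for t
    proof -
      have "r (c *\<^sub>R x) \<le> g (c *\<^sub>R x) (c * t)" using upper that \<open>c > 0\<close> by simp
      also have "\<dots> = c * g x t"
        using hom[of c "x + t *\<^sub>R y"] \<open>c > 0\<close> by (simp add: g_def algebra_simps)
      finally show ?thesis using \<open>c > 0\<close> by (simp add: field_simps)
    qed
    then have "inverse c * r (c *\<^sub>R x) \<le> r x"
      unfolding r_def[of x] by (intro cINF_greatest) auto
    then show ?thesis using \<open>c > 0\<close> by (simp add: field_simps)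
  qed
  ultimately have "sublinear r" by (intro sublinearI)
  moreover have "r x \<le> q x" for x using upper[of 0 x] by (simp add: g_def)
  moreover have "r x \<le> q (x + y) - q y" for x using upper[of 1 x] by (simp add: g_def)
  ultimately show ?thesis using that by blast
qed

lemma sublinear_minorant_linear:
  fixes p :: "'a::real_vector \<Rightarrow> real"
  assumes p: "sublinear p"
  obtains u where "linear u" "\<And>x. u x \<le> p x"
proof -
  define S where "S = {q. sublinear q \<and> q \<le> p}"
  \<comment> \<open>The order is reversed because Zorn's lemma delivers a maximal element and a
    minimal functional is wanted.\<close>
  define P where "P a b \<longleftrightarrow> b \<le> a" for a b :: "'a \<Rightarrow> real"
  have "\<exists>m\<in>S. \<forall>a\<in>S. P m a \<longrightarrow> a = m"
  proof (rule predicate_Zorn)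
    show "partial_order_on S (relation_of P S)"
      by (rule partial_order_on_relation_ofI) (auto simp: P_def)
  next
    fix C assume C: "C \<in> Chains (relation_of P S)"
    then have CS: "C \<subseteq> S" and tot: "\<And>a b. a \<in> C \<Longrightarrow> b \<in> C \<Longrightarrow> a \<le> b \<or> b \<le> a"
      by (auto simp: Chains_def relation_of_def P_def)
    show "\<exists>u\<in>S. \<forall>a\<in>C. P a u"
    \<comment> \<open>The empty chain is treated apart, as an infimum over it has no meaning;
      \<open>p\<close> itself bounds it.\<close>
    proof (cases "C = {}")
      case True
      then show ?thesis using p by (auto simp: S_def)
    next
      case False
      define r where "r x = (INF q\<in>C. q x)" for x
      have bdd: "bdd_below ((\<lambda>q. q x) ` C)" for x
      proof (rule bdd_belowI2)
        fix q assume "q \<in> C"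
        then have "sublinear q" "q (- x) \<le> p (- x)" using CS by (auto simp: S_def le_fun_def)
        then show "- p (- x) \<le> q x" using sublinear_minus[of q x] by linarith
      qed
      have lower: "r x \<le> q x" if "q \<in> C" for q x
        unfolding r_def by (rule cINF_lower[OF bdd that])
      have "r (x + z) \<le> r x + r z" for x z
      proof -
        have *: "r (x + z) - q' z \<le> q x" if qq': "q \<in> C" "q' \<in> C" for q q'
        proof -
          \<comment> \<open>Subadditivity of the infimum involves two members of the chain at once;
            the smaller of the two serves for both.\<close>
          obtain m where m: "m \<in> C" "m \<le> q" "m \<le> q'" using tot[OF qq'] qq' by blast
          then have "m (x + z) \<le> m x + m z" using CS by (auto simp: S_def sublinear_def)
          then show ?thesis using lower[OF m(1), of "x + z"] m(2,3)
            by (smt (verit) le_fun_def)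
        qed
        have "r (x + z) - q' z \<le> r x" if "q' \<in> C" for q'
          unfolding r_def[of x] by (rule cINF_greatest) (use * that False in auto)
        then have "r (x + z) - r x \<le> q' z" if "q' \<in> C" for q' using that by (smt (verit))
        then have "r (x + z) - r x \<le> r z"
          unfolding r_def[of z] using False by (intro cINF_greatest) auto
        then show ?thesis by simp
      qed
      moreover have "r 0 = 0"
      proof -
        have "q 0 = 0" if "q \<in> C" for q using that CS sublinear_zero by (auto simp: S_def)
        then have "r 0 = (INF q\<in>C. 0)" unfolding r_def by (intro INF_cong) auto
        then show ?thesis using False by simp
      qed
      moreover have "r (c *\<^sub>R x) \<le> c * r x" if "c > 0" for c x
      proof -
        have "inverse c * r (c *\<^sub>R x) \<le> q x" if "q \<in> C" for q
        proof -
          have "q (c *\<^sub>R x) = c * q x"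
            using that CS \<open>c > 0\<close> by (auto simp: S_def sublinear_def)
          then have "r (c *\<^sub>R x) \<le> c * q x" using lower[OF that] by metis
          then show ?thesis using \<open>c > 0\<close> by (simp add: field_simps)
        qed
        then have "inverse c * r (c *\<^sub>R x) \<le> r x"
          unfolding r_def[of x] using False by (intro cINF_greatest) auto
        then show ?thesis using \<open>c > 0\<close> by (simp add: field_simps)
      qed
      ultimately have "sublinear r" by (intro sublinearI)
      moreover have "r \<le> p"
      proof -
        obtain q where "q \<in> C" "q \<le> p" using False CS by (auto simp: S_def)
        then show ?thesis using lower by (meson le_funI le_funD order_trans)
      qed
      ultimately have "r \<in> S" by (simp add: S_def)
      then show ?thesis using lower by (auto simp: P_def le_fun_def)
    qed
  qed
  then obtain m where m: "sublinear m" "m \<le> p"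
    and min: "\<And>a. sublinear a \<Longrightarrow> a \<le> m \<Longrightarrow> a = m"
    unfolding S_def P_def by (smt (verit) mem_Collect_eq order_trans)
  have add: "m (x + y) = m x + m y" for x y
  proof -
    obtain r where r: "sublinear r" "\<And>x. r x \<le> m x" "\<And>x. r x \<le> m (x + y) - m y"
      using sublinear_shift[OF m(1), of y] by blast
    then have "r = m" using min by (auto simp: le_fun_def)
    with r(3)[of x] have "m x \<le> m (x + y) - m y" by simp
    moreover have "m (x + y) \<le> m x + m y" using m(1) by (simp add: sublinear_def)
    ultimately show ?thesis by simp
  qed
  have neg: "m (- x) = - m x" for x
    using add[of x "- x"] sublinear_zero[OF m(1)] by simp
  have "m (c *\<^sub>R x) = c *\<^sub>R m x" for c x
  proof (cases "c \<ge> 0")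
    case True
    then show ?thesis using m(1) by (simp add: sublinear_def)
  next
    case False
    then have "m ((- c) *\<^sub>R x) = - c * m x"
      using m(1) unfolding sublinear_def by (metis linorder_linear neg_le_0_iff_le)
    then show ?thesis using neg[of "c *\<^sub>R x"] by simp
  qed
  with add have "linear m" by (intro linearI)
  then show ?thesis using that m(2) by (auto simp: le_fun_def)
qed

text \<open>A linear minorant of the norm need not attain the norm at \<open>v\<close>. Shifting by
  \<open>v\<close> beforehand forces the value at \<open>- v\<close> down to at most
  \<open>- norm v\<close>, so equality at \<open>v\<close> survives the passage to the
  minorant.\<close>

lemma real_norming_functional:
  fixes v :: "'a::real_normed_vector"
  obtains u where "linear u" "\<And>x. u x \<le> norm x" "u v = norm v"
proof -
  have "sublinear (norm :: 'a \<Rightarrow> real)"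
    by (simp add: sublinear_def norm_triangle_ineq)
  then obtain r where r: "sublinear r" "\<And>x. r x \<le> norm x" "\<And>x. r x \<le> norm (x + v) - norm v"
    using sublinear_shift[of norm v] by blast
  obtain u where u: "linear u" "\<And>x. u x \<le> r x"
    using sublinear_minorant_linear[OF r(1)] by blast
  have "- u v \<le> - norm v"
    using u(2)[of "- v"] r(3)[of "- v"] linear_neg[OF u(1), of v] by simp
  moreover have le: "u x \<le> norm x" for x using u(2) r(2) order_trans by blast
  ultimately have "u v = norm v" using le[of v] by linarith
  with u(1) le show ?thesis using that by blast
qed

text \<open>The usual complexification \<open>u x - \<i> * u (\<i> *\<^sub>C x)\<close> of a real
  norming functional \<open>u\<close>.\<close>

lemma complex_norming_functional:
  fixes v :: "'a::complex_normed_vector"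
  obtains \<Lambda> :: "'a \<Rightarrow> complex" where "bounded_linear \<Lambda>" "\<And>c x. \<Lambda> (c *\<^sub>C x) = c * \<Lambda> x"
    "\<And>x. cmod (\<Lambda> x) \<le> norm x" "\<Lambda> v = norm v"
proof -
  obtain u where u: "linear u" "\<And>x. u x \<le> norm x" "u v = norm v"
    using real_norming_functional[of v] by blast
  define \<Lambda> where "\<Lambda> x = Complex (u x) (- u (\<i> *\<^sub>C x))" for x
  have uadd: "u (x + y) = u x + u y" and uscale: "u (r *\<^sub>R x) = r * u x" for x y r
    using linear_add[OF u(1)] linear_scale[OF u(1)] by auto
  have add: "\<Lambda> (x + y) = \<Lambda> x + \<Lambda> y" for x y
    by (simp add: \<Lambda>_def uadd scaleC_add_right complex_eq_iff)
  have real: "\<Lambda> (complex_of_real r *\<^sub>C x) = r * \<Lambda> x" for r x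
  proof -
    have "\<i> *\<^sub>C (complex_of_real r *\<^sub>C x) = complex_of_real r *\<^sub>C (\<i> *\<^sub>C x)"
      by (simp add: scaleC_scaleC mult.commute)
    then show ?thesis
      by (simp add: \<Lambda>_def complex_eq_iff scaleR_scaleC[symmetric] uscale)
  qed
  have imag: "\<Lambda> (\<i> *\<^sub>C x) = \<i> * \<Lambda> x" for x
  proof -
    have "\<i> *\<^sub>C (\<i> *\<^sub>C x) = (- 1) *\<^sub>R x"
      by (simp add: scaleC_scaleC scaleR_scaleC del: scaleR_minus1_left)
    then have "u (\<i> *\<^sub>C (\<i> *\<^sub>C x)) = - u x" using uscale[of "- 1" x] by simp
    then show ?thesis by (simp add: \<Lambda>_def complex_eq_iff)
  qed
  have scale: "\<Lambda> (c *\<^sub>C x) = c * \<Lambda> x" for c x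
  proof -
    have "c *\<^sub>C x = complex_of_real (Re c) *\<^sub>C x + \<i> *\<^sub>C (complex_of_real (Im c) *\<^sub>C x)"
      by (metis complex_eq scaleC_add_left scaleC_scaleC)
    then have "\<Lambda> (c *\<^sub>C x) = Re c * \<Lambda> x + \<i> * (Im c * \<Lambda> x)"
      by (simp only: add real imag)
    also have "\<dots> = c * \<Lambda> x"
      by (metis complex_eq distrib_right mult.assoc)
    finally show ?thesis .
  qed
  have le: "cmod (\<Lambda> x) \<le> norm x" for x
  proof -
    \<comment> \<open>The unimodular \<open>c\<close> rotates \<open>\<Lambda> x\<close> onto the
      nonnegative real axis, where \<open>\<Lambda>\<close> agrees with the real functional
      \<open>u\<close>, and \<open>u\<close> is bounded by the norm.\<close>
    obtain c where c: "cmod c = 1" "c * \<Lambda> x = cmod (\<Lambda> x)"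
    proof (cases "\<Lambda> x = 0")
      case True
      then show ?thesis using that[of 1] by simp
    next
      case False
      show ?thesis
      proof (rule that[of "cnj (\<Lambda> x) / cmod (\<Lambda> x)"])
        have "cnj (\<Lambda> x) * \<Lambda> x = complex_of_real (cmod (\<Lambda> x)) * cmod (\<Lambda> x)"
          using complex_norm_square[of "\<Lambda> x"] by (simp add: power2_eq_square mult.commute)
        then show "cnj (\<Lambda> x) / cmod (\<Lambda> x) * \<Lambda> x = cmod (\<Lambda> x)"
          using False by (simp add: field_simps)
      qed (use False in \<open>simp add: norm_divide\<close>)
    qed
    have "cmod (\<Lambda> x) = Re (\<Lambda> (c *\<^sub>C x))" using c(2) by (simp add: scale)
    also have "\<dots> \<le> norm (c *\<^sub>C x)" using u(2) by (simp add: \<Lambda>_def)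
    also have "\<dots> = norm x" using c(1) by (simp add: norm_scaleC)
    finally show ?thesis .
  qed
  have "bounded_linear \<Lambda>"
  proof (rule bounded_linear_intro[where K = 1])
    show "\<Lambda> (r *\<^sub>R x) = r *\<^sub>R \<Lambda> x" for r x
      by (metis scale scaleR_scaleC scaleR_conv_of_real)
  qed (use add le in auto)
  moreover have "\<Lambda> v = norm v"
  proof (rule complex_eqI)
    show re: "Re (\<Lambda> v) = Re (complex_of_real (norm v))" using u(3) by (simp add: \<Lambda>_def)
    \<comment> \<open>The real part alone already has size \<open>norm v\<close>, so the bound on
      the modulus leaves nothing for the imaginary part.\<close>
    have "(Re (\<Lambda> v))\<^sup>2 + (Im (\<Lambda> v))\<^sup>2 \<le> (norm v)\<^sup>2"
      using power_mono[OF le[of v], of 2] by (simp add: cmod_power2)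
    then show "Im (\<Lambda> v) = Im (complex_of_real (norm v))" using re by simp
  qed
  ultimately show ?thesis using that scale le by blast
qed

section \<open>Schwarz estimates for holomorphic maps between normed spaces\<close>

text \<open>On the circle of radius \<open>s < r\<close> the quotient is at most
  \<open>K / s\<close>; the maximum principle carries this inside, and \<open>s\<close> then tends
  to \<open>r\<close>.\<close>

lemma holomorphic_divide_by_id:
  fixes g :: "complex \<Rightarrow> complex"
  assumes r: "r > 0" and hol: "g holomorphic_on ball 0 r" and g0: "g 0 = 0"
    and K: "\<And>z. cmod z < r \<Longrightarrow> cmod (g z) \<le> K"
  obtains h where "h holomorphic_on ball 0 r" "\<And>z. cmod z < r \<Longrightarrow> g z = z * h z"
    "\<And>z. cmod z < r \<Longrightarrow> cmod (h z) \<le> K / r"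
proof -
  obtain h where h: "h holomorphic_on ball 0 r" "\<And>z. cmod z < r \<Longrightarrow> g z = z * h z"
    using Schwarz3[OF hol g0] by blast
  have "cmod (h z) \<le> K / r" if z: "cmod z < r" for z
  proof -
    have *: "cmod (h z) * s \<le> K" if s: "cmod z < s" "s < r" for s
    proof -
      have s0: "0 < s" using s(1) norm_ge_zero[of z] by linarith
      have sub: "cball 0 s \<subseteq> ball 0 r" using s(2) by auto
      have "cmod (h z) \<le> K / s"
      proof (rule maximum_modulus_frontier[of h "cball 0 s"])
        show "h holomorphic_on interior (cball 0 s)"
          using h(1) sub interior_subset holomorphic_on_subset by blast
        show "continuous_on (closure (cball 0 s)) h"
          using holomorphic_on_imp_continuous_on[OF h(1)] sub continuous_on_subset by (metis closed_cball closure_closed)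
        show "z \<in> cball 0 s" using s(1) by simp
        fix w :: complex assume "w \<in> frontier (cball 0 s)"
        then have w: "cmod w = s" by simp
        then have "s * cmod (h w) = cmod (g w)" using h(2)[of w] s(2) by (simp add: norm_mult)
        also have "\<dots> \<le> K" using K w s(2) by simp
        finally show "cmod (h w) \<le> K / s" using s0 by (simp add: field_simps)
      qed simp
      then show ?thesis using s0 by (simp add: field_simps)
    qed
    have "cmod (h z) * r \<le> K"
    proof (rule tendsto_upperbound)
      show "((\<lambda>s. cmod (h z) * s) \<longlongrightarrow> cmod (h z) * r) (at_left r)"
        by (intro tendsto_intros)
      show "\<forall>\<^sub>F s in at_left r. cmod (h z) * s \<le> K"
        using eventually_at_left_real[OF z] by eventually_elim (use * in auto)
    qed simp
    then show ?thesis using r by (simp add: field_simps)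
  qed
  then show ?thesis using that[OF h] by simp
qed

text \<open>One factor \<open>z\<close> is split off per step, and each division improves the bound
  by \<open>1 / r\<close>. Flatness makes the quotient vanish at 0 as long as at most
  \<open>ell\<close> factors have been removed, so the last division is one beyond
  \<open>\<lfloor>ell\<rfloor>\<close>.\<close>

lemma holomorphic_flat_bound:
  fixes g :: "complex \<Rightarrow> complex"
  assumes r: "r > 0" and hol: "g holomorphic_on ball 0 r" and g0: "g 0 = 0"
    and K: "\<And>z. cmod z < r \<Longrightarrow> cmod (g z) \<le> K"
    and flat: "((\<lambda>z. cmod (g z) / cmod z powr ell) \<longlongrightarrow> 0) (at 0)"
    and z: "cmod z < r"
  shows "cmod (g z) \<le> K * (cmod z / r) ^ (nat \<lfloor>ell\<rfloor> + 1)"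
proof -
  have "\<exists>h. h holomorphic_on ball 0 r \<and>
          (\<forall>z. cmod z < r \<longrightarrow> g z = z ^ k * h z \<and> cmod (h z) \<le> K / r ^ k)"
    if "k \<le> nat \<lfloor>ell\<rfloor> + 1" for k
    using that
  proof (induction k)
    case 0
    then show ?case using hol K by auto
  next
    case (Suc k)
    then obtain h where h: "h holomorphic_on ball 0 r"
      "\<And>z. cmod z < r \<Longrightarrow> g z = z ^ k * h z" "\<And>z. cmod z < r \<Longrightarrow> cmod (h z) \<le> K / r ^ k"
      by auto
    have "h 0 = 0"
    \<comment> \<open>The first factor comes from \<open>g 0 = 0\<close>, whatever the sign of
      \<open>ell\<close>. For \<open>k > 0\<close> the bound on \<open>Suc k\<close> gives
      \<open>k \<le> ell\<close>, so that flatness applies.\<close>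
    proof (cases "k = 0")
      case True
      then show ?thesis using h(2)[of 0] r g0 by simp
    next
      case False
      then have k: "real k \<le> ell" using Suc.prems by linarith
      have "isCont h 0"
        using h(1) r holomorphic_on_imp_continuous_on continuous_on_eq_continuous_at
        by (metis centre_in_ball open_ball)
      then have "((\<lambda>z. cmod (h z)) \<longlongrightarrow> cmod (h 0)) (at 0)"
        by (intro tendsto_norm) (simp add: isCont_def)
      moreover have "((\<lambda>z. cmod (h z)) \<longlongrightarrow> 0) (at 0)"
      proof (rule tendsto_sandwich[OF _ _ tendsto_const flat])
        have "\<forall>\<^sub>F z in at (0::complex). cmod z < r \<and> cmod z < 1 \<and> z \<noteq> 0"
          unfolding eventually_at by (rule exI[of _ "min r 1"]) (use r in auto)
        then show "\<forall>\<^sub>F z in at 0. cmod (h z) \<le> cmod (g z) / cmod z powr ell"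
        proof eventually_elim
          case (elim z)
          then have z: "cmod z < r" "cmod z \<le> 1" "cmod z > 0" by auto
          \<comment> \<open>For \<open>cmod z \<le> 1\<close> the larger exponent gives the smaller
            power; thus \<open>cmod (h z)\<close> is dominated by the flat quotient of
            \<open>g\<close>.\<close>
          have "cmod z powr ell \<le> cmod z ^ k"
            using powr_mono'[OF k, of "cmod z"] z by (simp add: powr_realpow)
          then have "cmod (h z) * cmod z powr ell \<le> cmod (g z)"
            using h(2)[OF z(1)] by (simp add: norm_mult norm_power mult.commute mult_left_mono)
          then show ?case using z by (simp add: field_simps)
        qed
      qed simp
      ultimately show ?thesis using LIM_unique by fastforce
    qed
    obtain h' where h': "h' holomorphic_on ball 0 r" "\<And>z. cmod z < r \<Longrightarrow> h z = z * h' z"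
      "\<And>z. cmod z < r \<Longrightarrow> cmod (h' z) \<le> (K / r ^ k) / r"
      using holomorphic_divide_by_id[OF r h(1) \<open>h 0 = 0\<close> h(3)] by blast
    show ?case
      by (rule exI[of _ h']) (use h' h(2) in \<open>auto simp: mult.commute\<close>)
  qed
  then obtain h where h: "g z = z ^ (nat \<lfloor>ell\<rfloor> + 1) * h z" "cmod (h z) \<le> K / r ^ (nat \<lfloor>ell\<rfloor> + 1)"
    using z by blast
  have "cmod (g z) = cmod z ^ (nat \<lfloor>ell\<rfloor> + 1) * cmod (h z)"
    using h(1) by (simp add: norm_mult norm_power)
  also have "\<dots> \<le> cmod z ^ (nat \<lfloor>ell\<rfloor> + 1) * (K / r ^ (nat \<lfloor>ell\<rfloor> + 1))"
    by (intro mult_left_mono h(2)) simp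
  finally show ?thesis by (simp add: power_divide mult_ac)
qed

section \<open>Holomorphic maps with values in a normed space\<close>

lemma has_derivative_diff_const:
  "(h has_derivative L) F \<Longrightarrow> ((\<lambda>x. h x - c) has_derivative L) F"
  using has_derivative_diff[OF _ has_derivative_const, of h L F c] by simp

lemma bounded_linear_scaleC_left: "bounded_linear (\<lambda>z. z *\<^sub>C (v::'a::complex_normed_vector))"
  by (rule bounded_linear_intro[where K = "norm v"])
    (simp_all add: scaleC_add_left scaleR_scaleC[where 'a = 'a] scaleC_scaleC scaleR_conv_of_real[where 'a = complex] norm_scaleC)

lemma scaleC_right_diff: "a *\<^sub>C (x - y) = a *\<^sub>C x - a *\<^sub>C (y::'a::complex_normed_vector)"
  by (metis add_diff_cancel diff_add_cancel scaleC_add_right)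

lemma holo_on_subset: "holo_on D h \<Longrightarrow> S \<subseteq> D \<Longrightarrow> holo_on S h"
  unfolding holo_on_def by blast

lemma holo_on_imp_isCont: "holo_on D h \<Longrightarrow> x \<in> D \<Longrightarrow> isCont h x"
  unfolding holo_on_def using has_derivative_continuous by blast

text \<open>A holomorphic map that is \<open>o(\<parallel>x - x\<^sub>0\<parallel>\<^sup>\<ell>)\<close> has no Taylor terms of degree \<open>\<le> \<ell>\<close>, so
  Schwarz' lemma applies to its restrictions to complex lines, composed with norming functionals.\<close>

lemma holo_on_flat_bound:
  fixes h :: "'a::complex_normed_vector \<Rightarrow> 'b::complex_normed_vector"
  assumes hol: "holo_on (ball x0 R) h" and K: "\<And>y. y \<in> ball x0 R \<Longrightarrow> norm (h y - h x0) \<le> K"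
    and flat: "((\<lambda>y. norm (h y - h x0) / norm (y - x0) powr ell) \<longlongrightarrow> 0) (at x0)"
    and x: "x \<in> ball x0 R"
  shows "norm (h x - h x0) \<le> K * (norm (x - x0) / R) ^ (nat \<lfloor>ell\<rfloor> + 1)"
proof (cases "x = x0")
  case False
  define v where "v = x - x0"
  have v: "norm v > 0" "norm v < R" using False x by (auto simp: v_def dist_norm norm_minus_commute)
  then have R: "R > 0" by linarith
  \<comment> \<open>The disc of radius \<open>r\<close> is the set of \<open>z\<close> for which
    \<open>x0 + z *\<^sub>C v\<close> stays in the ball. The point \<open>x\<close> is
    \<open>z = 1\<close>, and \<open>1 / r\<close> is the desired ratio
    \<open>norm (x - x0) / R\<close>.\<close>
  define r where "r = R / norm v"
  have r: "r > 0" "1 < r" using v R by (auto simp: r_def)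
  obtain \<Lambda> :: "'b \<Rightarrow> complex" where \<Lambda>: "bounded_linear \<Lambda>" "\<And>c x. \<Lambda> (c *\<^sub>C x) = c * \<Lambda> x"
    "\<And>x. cmod (\<Lambda> x) \<le> norm x" "\<Lambda> (h x - h x0) = norm (h x - h x0)"
    using complex_norming_functional by blast
  define g where "g z = \<Lambda> (h (x0 + z *\<^sub>C v) - h x0)" for z
  have inball: "x0 + z *\<^sub>C v \<in> ball x0 R" if "cmod z < r" for z
    using that v by (simp add: r_def dist_norm norm_scaleC field_simps)
  have "cmod (g 1) \<le> K * (cmod 1 / r) ^ (nat \<lfloor>ell\<rfloor> + 1)"
  proof (rule holomorphic_flat_bound[OF r(1)])
    show "g 0 = 0"
    proof -
      have "0 *\<^sub>C v = 0" by (metis norm_scaleC mult_zero_left norm_eq_zero norm_zero)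
      then show ?thesis using linear_0[OF bounded_linear.linear[OF \<Lambda>(1)]] by (simp add: g_def)
    qed
    show "cmod (g z) \<le> K" if "cmod z < r" for z
      using \<Lambda>(3) K[OF inball[OF that]] by (auto simp: g_def intro: order_trans)
    have "\<exists>d. (g has_field_derivative d) (at z)" if z: "cmod z < r" for z
    proof -
      obtain L where L: "(h has_derivative L) (at (x0 + z *\<^sub>C v))" "\<And>c w. L (c *\<^sub>C w) = c *\<^sub>C L w"
        using hol inball[OF z] unfolding holo_on_def by blast
      have "((\<lambda>z. x0 + z *\<^sub>C v) has_derivative (\<lambda>w. w *\<^sub>C v)) (at z)"
        using has_derivative_add[OF has_derivative_const bounded_linear_imp_has_derivative[OF bounded_linear_scaleC_left], of x0] by simp
      then have "((\<lambda>z. h (x0 + z *\<^sub>C v)) has_derivative (\<lambda>w. L (w *\<^sub>C v))) (at z)"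
        using L(1) by (rule has_derivative_compose)
      then have "(g has_derivative (\<lambda>w. \<Lambda> (L (w *\<^sub>C v)))) (at z)"
        unfolding g_def
        by (intro bounded_linear.has_derivative[OF \<Lambda>(1)] has_derivative_diff_const)
      moreover have "(\<lambda>w. \<Lambda> (L (w *\<^sub>C v))) = (*) (\<Lambda> (L v))"
        by (simp add: L(2) \<Lambda>(2) fun_eq_iff mult.commute)
      ultimately show ?thesis unfolding has_field_derivative_def by metis
    qed
    then show "g holomorphic_on ball 0 r"
      by (auto simp: holomorphic_on_open)
    have lim: "filterlim (\<lambda>z. x0 + z *\<^sub>C v) (at x0) (at 0)"
      unfolding filterlim_at
    proof
      have "((\<lambda>z. x0 + z *\<^sub>C v) \<longlongrightarrow> x0 + 0 *\<^sub>C v) (at 0)"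
        by (intro tendsto_intros bounded_linear.tendsto[OF bounded_linear_scaleC_left])
      moreover have "0 *\<^sub>C v = 0" by (metis norm_scaleC mult_zero_left norm_eq_zero norm_zero)
      ultimately show "((\<lambda>z. x0 + z *\<^sub>C v) \<longlongrightarrow> x0) (at 0)" by simp
      have "\<forall>\<^sub>F z in at 0. z \<noteq> (0::complex)" by (rule eventually_neq_at_within)
      then show "\<forall>\<^sub>F z in at 0. x0 + z *\<^sub>C v \<in> UNIV \<and> x0 + z *\<^sub>C v \<noteq> x0"
      proof eventually_elim
        case (elim z)
        then have "norm (z *\<^sub>C v) \<noteq> 0" using v by (simp add: norm_scaleC)
        then show ?case by auto
      qed
    qed
    \<comment> \<open>Since \<open>norm (z *\<^sub>C v) = cmod z * norm v\<close>, the constant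
      \<open>norm v powr ell\<close> turns flatness in \<open>y - x0\<close> into flatness in
      \<open>z\<close>.\<close>
    have "((\<lambda>z. norm v powr ell * (norm (h (x0 + z *\<^sub>C v) - h x0) / norm (x0 + z *\<^sub>C v - x0) powr ell))
             \<longlongrightarrow> norm v powr ell * 0) (at 0)"
      by (intro tendsto_intros filterlim_compose[OF flat lim])
    then have lim0: "((\<lambda>z. norm (h (x0 + z *\<^sub>C v) - h x0) / cmod z powr ell) \<longlongrightarrow> 0) (at 0)"
      using v by (simp add: norm_scaleC powr_mult)
    show "((\<lambda>z. cmod (g z) / cmod z powr ell) \<longlongrightarrow> 0) (at 0)"
      by (rule tendsto_sandwich[OF _ _ tendsto_const lim0])
        (auto simp: g_def intro!: always_eventually divide_right_mono \<Lambda>(3))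
  qed (use r in simp)
  moreover have "1 *\<^sub>C v = v" by (rule scaleC_one)
  ultimately show ?thesis using \<Lambda>(4) by (simp add: g_def v_def r_def)
qed (use x in simp)

text \<open>The case \<open>ell = 0\<close> of the flat bound, with exponent 1: continuity at
  \<open>x0\<close> is flatness of order 0. The identification is made on a punctured neighbourhood
  because \<open>0 powr 0 = 0\<close>.\<close>

lemma holo_on_schwarz:
  fixes h :: "'a::complex_normed_vector \<Rightarrow> 'b::complex_normed_vector"
  assumes hol: "holo_on (ball x0 R) h" and K: "\<And>y. y \<in> ball x0 R \<Longrightarrow> norm (h y - h x0) \<le> K"
    and x: "x \<in> ball x0 R"
  shows "norm (h x - h x0) \<le> K / R * norm (x - x0)"
proof -
  have R: "x0 \<in> ball x0 R" using x le_less_trans[OF zero_le_dist, of x0 x R] by simp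
  have "((\<lambda>y. norm (h y - h x0)) \<longlongrightarrow> norm (h x0 - h x0)) (at x0)"
    using holo_on_imp_isCont[OF hol R] by (intro tendsto_intros) (simp add: isCont_def)
  moreover have "\<forall>\<^sub>F y in at x0. norm (h y - h x0) = norm (h y - h x0) / norm (y - x0) powr 0"
    using eventually_neq_at_within[of x0 x0 UNIV] by eventually_elim simp
  ultimately have "((\<lambda>y. norm (h y - h x0) / norm (y - x0) powr 0) \<longlongrightarrow> 0) (at x0)"
    using Lim_transform_eventually by fastforce
  from holo_on_flat_bound[OF hol K this x] show ?thesis by (simp add: mult.commute)
qed

lemma has_derivative_norm_le:
  assumes L: "(h has_derivative L) (at x0)" and R: "R > 0"
    and lip: "\<And>y. dist y x0 < R \<Longrightarrow> norm (h y - h x0) \<le> C * norm (y - x0)"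
  shows "norm (L v) \<le> C * norm v"
proof (rule field_le_epsilon)
  fix e :: real assume e: "e > 0"
  define e' where "e' = e / (norm v + 1)"
  have e': "e' > 0" "e' * norm v \<le> e" using e
    by (auto simp: e'_def field_simps add_pos_nonneg)
  obtain d where d: "d > 0"
    "\<And>y. norm (y - x0) < d \<Longrightarrow> norm (h y - h x0 - L (y - x0)) \<le> e' * norm (y - x0)"
    using L e' unfolding has_derivative_at_alt by blast
  \<comment> \<open>The factor \<open>1/2\<close> makes \<open>t * norm v\<close> strictly smaller
    than both radii; the \<open>+ 1\<close> covers \<open>v = 0\<close>.\<close>
  define t where "t = min d R / 2 / (norm v + 1)"
  have cancel: "a / b * b = a" if "b > 0" for a b :: real using that by simp
  have n: "norm v + 1 > 0" by (simp add: add_nonneg_pos)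
  have t: "t > 0" unfolding t_def using d R n by (intro divide_pos_pos) auto
  have "t * norm v \<le> t * (norm v + 1)" using t by simp
  also have "\<dots> = min d R / 2" unfolding t_def using n by (rule cancel)
  also have "\<dots> < min d R" using d(1) R by (simp add: min_def)
  finally have tv: "norm (t *\<^sub>R v) < d" "norm (t *\<^sub>R v) < R" using t by auto
  have 1: "norm (h (x0 + t *\<^sub>R v) - h x0) \<le> C * norm (t *\<^sub>R v)"
    using lip[of "x0 + t *\<^sub>R v"] tv(2) by (simp only: dist_norm add_diff_cancel_left')
  have 2: "norm (h (x0 + t *\<^sub>R v) - h x0 - L (t *\<^sub>R v)) \<le> e' * norm (t *\<^sub>R v)"
    using d(2)[of "x0 + t *\<^sub>R v"] tv(1) by (simp only: add_diff_cancel_left')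
  have "norm (L (t *\<^sub>R v)) \<le> norm (h (x0 + t *\<^sub>R v) - h x0) + norm (h (x0 + t *\<^sub>R v) - h x0 - L (t *\<^sub>R v))"
    using norm_triangle_ineq4[of "h (x0 + t *\<^sub>R v) - h x0" "h (x0 + t *\<^sub>R v) - h x0 - L (t *\<^sub>R v)"] by simp
  also have "\<dots> \<le> C * norm (t *\<^sub>R v) + e' * norm (t *\<^sub>R v)"
    using 1 2 by (rule add_mono)
  finally have "t * norm (L v) \<le> t * (C * norm v + e' * norm v)"
    using linear_scale[OF has_derivative_linear[OF L]] t by (simp add: algebra_simps)
  then have "norm (L v) \<le> C * norm v + e' * norm v" using t by simp
  with e' show "norm (L v) \<le> C * norm v + e" by linarith
qed

text \<open>A Cauchy estimate obtained from Schwarz' lemma instead of an integral formula. The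
  factor 2 is the price for passing from \<open>h\<close> to \<open>h - h x0\<close>.\<close>

lemma holo_on_derivative_bound:
  fixes h :: "'a::complex_normed_vector \<Rightarrow> 'b::complex_normed_vector"
  assumes hol: "holo_on (ball x0 R) h" and R: "R > 0" and K: "\<And>y. y \<in> ball x0 R \<Longrightarrow> norm (h y) \<le> K"
    and L: "(h has_derivative L) (at x0)"
  shows "norm (L v) \<le> 2 * K / R * norm v"
proof (rule has_derivative_norm_le[OF L R])
  fix y assume y: "dist y x0 < R"
  show "norm (h y - h x0) \<le> 2 * K / R * norm (y - x0)"
  proof (rule holo_on_schwarz[OF hol])
    fix z assume "z \<in> ball x0 R"
    then have "norm (h z) \<le> K" "norm (h x0) \<le> K" using K R by auto
    then show "norm (h z - h x0) \<le> 2 * K" using norm_triangle_ineq4[of "h z" "h x0"] by linarith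
  qed (use y in \<open>simp add: dist_commute\<close>)
qed

section \<open>Locally uniform limits of holomorphic maps\<close>

lemma bounded_linear_scaleC_right: "bounded_linear (\<lambda>x::'a::complex_normed_vector. c *\<^sub>C x)"
  by (rule bounded_linear_intro[where K = "cmod c"])
    (simp_all add: scaleC_add_right scaleR_scaleC[where 'a = 'a] scaleC_scaleC norm_scaleC mult.commute)

lemma holo_on_diff:
  assumes "holo_on D g" "holo_on D h"
  shows "holo_on D (\<lambda>x. g x - h x)"
  unfolding holo_on_def
proof
  fix x assume "x \<in> D"
  then obtain L L' where "(g has_derivative L) (at x)" "\<And>c v. L (c *\<^sub>C v) = c *\<^sub>C L v"
    "(h has_derivative L') (at x)" "\<And>c v. L' (c *\<^sub>C v) = c *\<^sub>C L' v"
    using assms unfolding holo_on_def by blast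
  then show "\<exists>L. ((\<lambda>x. g x - h x) has_derivative L) (at x) \<and> (\<forall>c v. L (c *\<^sub>C v) = c *\<^sub>C L v)"
    by (intro exI[of _ "\<lambda>v. L v - L' v"]) (auto intro: has_derivative_diff simp: scaleC_right_diff)
qed

text \<open>Weierstrass' theorem: by the Cauchy estimate, uniform closeness of the maps on a ball
  makes their derivatives uniformly Cauchy on the half ball. The limit can then be differentiated,
  and complex homogeneity of the derivative is a pointwise limit.\<close>

lemma holo_on_uniform_limit:
  fixes h :: "nat \<Rightarrow> 'a::complex_normed_vector \<Rightarrow> 'b::{complex_normed_vector,banach}"
  assumes hol: "\<And>n. holo_on D (h n)"
    and lim: "\<And>x. x \<in> D \<Longrightarrow> \<exists>\<delta>>0. ball x \<delta> \<subseteq> D \<and> uniform_limit (ball x \<delta>) h g sequentially"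
  shows "holo_on D g"
  unfolding holo_on_def
proof
  fix x assume "x \<in> D"
  then obtain \<delta> where \<delta>: "\<delta> > 0" "ball x \<delta> \<subseteq> D" "uniform_limit (ball x \<delta>) h g sequentially"
    using lim by blast
  have "\<forall>n. \<forall>y. \<exists>L. y \<in> D \<longrightarrow> (h n has_derivative L) (at y) \<and> (\<forall>c v. L (c *\<^sub>C v) = c *\<^sub>C L v)"
    using hol unfolding holo_on_def by blast
  then obtain L where L: "\<And>n y. y \<in> D \<Longrightarrow> (h n has_derivative L n y) (at y)"
    "\<And>n y c v. y \<in> D \<Longrightarrow> L n y (c *\<^sub>C v) = c *\<^sub>C L n y v"
    unfolding choice_iff by blast
  define S where "S = ball x (\<delta> / 2)"
  have SD: "S \<subseteq> D" using \<delta> by (auto simp: S_def)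
  have sub: "ball y (\<delta> / 2) \<subseteq> ball x \<delta>" if "y \<in> S" for y
  proof
    fix z assume "z \<in> ball y (\<delta> / 2)"
    then show "z \<in> ball x \<delta>" using that dist_triangle[of x z y] by (simp add: S_def)
  qed
  have cauchy: "\<exists>N. \<forall>m\<ge>N. \<forall>n\<ge>N. \<forall>y\<in>S. \<forall>v. norm (L m y v - L n y v) \<le> e * norm v" if "e > 0" for e
  proof -
    \<comment> \<open>Two maps then differ by at most \<open>e * \<delta> / 4\<close>, and the
      Cauchy estimate on radius \<open>\<delta> / 2\<close> multiplies this by
      \<open>2 / (\<delta> / 2)\<close>, which gives exactly \<open>e\<close>.\<close>
    have "e * \<delta> / 8 > 0" using that \<delta>(1) by simp
    with \<delta>(3) obtain N where N: "\<And>n y. n \<ge> N \<Longrightarrow> y \<in> ball x \<delta> \<Longrightarrow> dist (h n y) (g y) < e * \<delta> / 8"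
      unfolding uniform_limit_iff eventually_sequentially by blast
    have "norm (L m y v - L n y v) \<le> e * norm v" if mn: "m \<ge> N" "n \<ge> N" and y: "y \<in> S" for m n y v
    proof -
      have "norm (L m y v - L n y v) \<le> 2 * (e * \<delta> / 4) / (\<delta> / 2) * norm v"
      proof (rule holo_on_derivative_bound)
        show "holo_on (ball y (\<delta> / 2)) (\<lambda>y. h m y - h n y)"
          using holo_on_subset[OF holo_on_diff[OF hol hol]] sub[OF y] \<delta>(2) by blast
        show "((\<lambda>y. h m y - h n y) has_derivative (\<lambda>v. L m y v - L n y v)) (at y)"
          using y SD by (intro has_derivative_diff L) auto
        fix z assume "z \<in> ball y (\<delta> / 2)"
        then have "z \<in> ball x \<delta>" using sub[OF y] by blast
        from N[OF mn(1) this] N[OF mn(2) this]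
        show "norm (h m z - h n z) \<le> e * \<delta> / 4"
          using dist_triangle2[of "h m z" "h n z" "g z"] by (simp add: dist_norm)
      qed (use \<delta> in simp)
      then show ?thesis using \<delta>(1) by simp
    qed
    then show ?thesis by blast
  qed
  have "\<exists>l. (\<lambda>n. L n y v) \<longlonglongrightarrow> l" if y: "y \<in> S" for y v
  proof -
    have "Cauchy (\<lambda>n. L n y v)"
    proof (rule metric_CauchyI)
      fix e :: real assume e: "e > 0"
      define e' where "e' = e / (norm v + 1)"
      have n: "norm v + 1 > 0" by (simp add: add_nonneg_pos)
      have e': "e' > 0" "e' * norm v < e" using e n by (auto simp: e'_def field_simps)
      obtain N where "\<forall>m\<ge>N. \<forall>n\<ge>N. \<forall>y\<in>S. \<forall>v. norm (L m y v - L n y v) \<le> e' * norm v"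
        using cauchy[OF e'(1)] by blast
      then show "\<exists>N. \<forall>m\<ge>N. \<forall>n\<ge>N. dist (L m y v) (L n y v) < e"
        using y e'(2) unfolding dist_norm by (meson le_less_trans)
    qed
    then show ?thesis using Cauchy_convergent_iff convergent_def by blast
  qed
  then obtain g' where g': "\<And>y v. y \<in> S \<Longrightarrow> (\<lambda>n. L n y v) \<longlonglongrightarrow> g' y v" by metis
  have "\<exists>G. \<forall>y\<in>S. (\<lambda>n. h n y) \<longlonglongrightarrow> G y \<and> (G has_derivative g' y) (at y within S)"
  proof (rule has_derivative_sequence)
    show "convex S" by (simp add: S_def)
    show "(h n has_derivative L n y) (at y within S)" if "y \<in> S" for n y
      using L(1) that SD by (blast intro: has_derivative_at_withinI)
    show "x \<in> S" using \<delta> by (simp add: S_def)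
    then show "(\<lambda>n. h n x) \<longlonglongrightarrow> g x"
      using tendsto_uniform_limitI[OF \<delta>(3), of x] \<delta>(1) by simp
    fix e :: real assume "e > 0"
    from cauchy[OF this] obtain N
      where N: "\<forall>m\<ge>N. \<forall>n\<ge>N. \<forall>y\<in>S. \<forall>v. norm (L m y v - L n y v) \<le> e * norm v" by blast
    have "norm (L n y v - g' y v) \<le> e * norm v" if "n \<ge> N" "y \<in> S" for n y v
    proof (rule tendsto_upperbound)
      show "(\<lambda>m. norm (L n y v - L m y v)) \<longlonglongrightarrow> norm (L n y v - g' y v)"
        using g'[OF that(2)] by (intro tendsto_intros)
      show "\<forall>\<^sub>F m in sequentially. norm (L n y v - L m y v) \<le> e * norm v"
        using N that unfolding eventually_sequentially by blast
    qed simp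
    then show "\<forall>\<^sub>F n in sequentially. \<forall>y\<in>S. \<forall>v. norm (L n y v - g' y v) \<le> e * norm v"
      unfolding eventually_sequentially by blast
  qed
  then obtain G where G: "\<And>y. y \<in> S \<Longrightarrow> (\<lambda>n. h n y) \<longlonglongrightarrow> G y"
    "\<And>y. y \<in> S \<Longrightarrow> (G has_derivative g' y) (at y within S)" by blast
  have xS: "x \<in> S" and opS: "open S" using \<delta> by (auto simp: S_def)
  have "G y = g y" if "y \<in> S" for y
  proof -
    have "y \<in> ball x \<delta>" using that \<delta>(1) by (simp add: S_def)
    then show ?thesis using LIMSEQ_unique[OF G(1)[OF that] tendsto_uniform_limitI[OF \<delta>(3)]] by blast
  qed
  then have "(g has_derivative g' x) (at x within S)"
    using G(2)[OF xS] xS by (metis has_derivative_transform)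
  then have "(g has_derivative g' x) (at x)" using at_within_open[OF xS opS] by simp
  moreover have "g' x (c *\<^sub>C v) = c *\<^sub>C g' x v" for c v
  proof (rule LIMSEQ_unique[OF g'[OF xS]])
    show "(\<lambda>n. L n x (c *\<^sub>C v)) \<longlonglongrightarrow> c *\<^sub>C g' x v"
      using bounded_linear.tendsto[OF bounded_linear_scaleC_right g'[OF xS]] L(2)[OF \<open>x \<in> D\<close>] by simp
  qed
  ultimately show "\<exists>L. (g has_derivative L) (at x) \<and> (\<forall>c v. L (c *\<^sub>C v) = c *\<^sub>C L v)" by blast
qed

section \<open>Operator exponentials and growth bounds\<close>

lemma op_pow_0 [simp]: "op_pow A 0 = id_blinfun"
  by (simp add: op_pow_def)

lemma op_pow_Suc: "op_pow A (Suc n) = A o\<^sub>L op_pow A n"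
  by (simp add: op_pow_def)

lemma op_pow_Suc': "op_pow A (Suc n) = op_pow A n o\<^sub>L A"
proof (induction n)
  case 0
  show ?case by (rule blinfun_eqI) (simp add: op_pow_Suc)
next
  case (Suc n)
  have "op_pow A (Suc (Suc n)) = A o\<^sub>L (op_pow A n o\<^sub>L A)" by (simp only: op_pow_Suc[of A "Suc n"] Suc)
  also have "\<dots> = op_pow A (Suc n) o\<^sub>L A" by (rule blinfun_eqI) (simp add: op_pow_Suc)
  finally show ?case .
qed

lemma norm_op_pow_le: "norm (op_pow A n) \<le> norm A ^ n"
proof (induction n)
  case 0
  show ?case by (simp add: norm_blinfun_id_le)
next
  case (Suc n)
  have "norm (op_pow A (Suc n)) \<le> norm A * norm (op_pow A n)"
    unfolding op_pow_Suc by (rule norm_blinfun_compose)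
  also have "\<dots> \<le> norm A * norm A ^ n" using Suc by (intro mult_left_mono) auto
  finally show ?case by simp
qed

lemma norm_op_exp_term_le:
  "norm ((t ^ n / fact n) *\<^sub>R op_pow A n) \<le> (\<bar>t\<bar> * norm A) ^ n /\<^sub>R fact n"
proof -
  have "norm ((t ^ n / fact n) *\<^sub>R op_pow A n) = \<bar>t\<bar> ^ n / fact n * norm (op_pow A n)"
    by (simp add: power_abs)
  also have "\<dots> \<le> \<bar>t\<bar> ^ n / fact n * norm A ^ n"
    by (intro mult_left_mono norm_op_pow_le) simp
  finally show ?thesis by (simp add: power_mult_distrib divide_inverse mult_ac)
qed

lemma summable_norm_op_exp: "summable (\<lambda>n. norm ((t ^ n / fact n) *\<^sub>R op_pow A n))"
  by (rule summable_comparison_test'[OF summable_exp_generic[of "\<bar>t\<bar> * norm A"]])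
    (use norm_op_exp_term_le in simp)

lemma summable_op_exp:
  fixes A :: "'a::banach \<Rightarrow>\<^sub>L 'a"
  shows "summable (\<lambda>n. (t ^ n / fact n) *\<^sub>R op_pow A n)"
  by (rule summable_norm_cancel[OF summable_norm_op_exp])

lemma norm_op_exp_le:
  fixes A :: "'a::banach \<Rightarrow>\<^sub>L 'a"
  shows "norm (op_exp t A) \<le> exp (\<bar>t\<bar> * norm A)"
proof -
  have "norm (op_exp t A) \<le> (\<Sum>n. norm ((t ^ n / fact n) *\<^sub>R op_pow A n))"
    unfolding op_exp_def by (rule summable_norm[OF summable_norm_op_exp])
  also have "\<dots> \<le> (\<Sum>n. (\<bar>t\<bar> * norm A) ^ n /\<^sub>R fact n)"
    by (intro suminf_le norm_op_exp_term_le summable_norm_op_exp summable_exp_generic)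
  finally show ?thesis by (simp add: exp_def)
qed

lemma op_exp_0 [simp]: "op_exp 0 A = id_blinfun"
proof -
  have "(\<lambda>n. (0 ^ n / fact n) *\<^sub>R op_pow A n) = (\<lambda>n. if n = 0 then id_blinfun else 0)"
    by (auto simp: fun_eq_iff)
  then have "op_exp 0 A = (\<Sum>n\<in>{0}. if n = 0 then id_blinfun else 0)"
    unfolding op_exp_def by (subst suminf_finite[of "{0}"]) auto
  then show ?thesis by simp
qed

text \<open>Termwise differentiation of the series on an open interval containing 0 and
  \<open>t\<close>. The factor \<open>A\<close> is placed on the right so that in
  \<open>op_exp (T - s) A v\<close> it acts on the vector \<open>v\<close> first.\<close>

lemma op_exp_has_vector_derivative:
  fixes A :: "'a::banach \<Rightarrow>\<^sub>L 'a"
  shows "((\<lambda>t. op_exp t A) has_vector_derivative op_exp t A o\<^sub>L A) (at t)"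
proof -
  define R where "R = \<bar>t\<bar> + 1"
  define S where "S = {- R<..<R}"
  define d where "d n s = (real n * s ^ (n - 1) / fact n) *\<^sub>R op_pow A n" for n s
  \<comment> \<open>A majorant on \<open>S\<close>: \<open>norm A\<close> times the exponential
    series of \<open>R * norm A\<close>, shifted by one index because the constant term has
    derivative 0.\<close>
  define b where "b n = (if n = 0 then 0 else norm A * ((R * norm A) ^ (n - 1) /\<^sub>R fact (n - 1)))" for n
  have dSuc: "d (Suc n) s = ((s ^ n / fact n) *\<^sub>R op_pow A n) o\<^sub>L A" for n s
  proof -
    have "real (Suc n) * s ^ n / fact (Suc n) = s ^ n / fact n"
      unfolding fact_Suc of_nat_mult by (rule mult_divide_mult_cancel_left) simp
    then show ?thesis
      by (simp add: d_def op_pow_Suc' bounded_bilinear.scaleR_left[OF bounded_bilinear_blinfun_compose] del: of_nat_Suc fact_Suc)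
  qed
  have bound: "norm (d n s) \<le> b n" if "s \<in> S" for n s
  proof (cases n)
    case 0
    then show ?thesis by (simp add: d_def b_def)
  next
    case (Suc k)
    have "norm (d n s) \<le> norm ((s ^ k / fact k) *\<^sub>R op_pow A k) * norm A"
      unfolding Suc dSuc by (rule norm_blinfun_compose)
    also have "\<dots> \<le> ((\<bar>s\<bar> * norm A) ^ k /\<^sub>R fact k) * norm A"
      by (intro mult_right_mono norm_op_exp_term_le) simp
    also have "\<dots> \<le> ((R * norm A) ^ k /\<^sub>R fact k) * norm A"
      using that by (intro mult_right_mono scaleR_left_mono power_mono) (auto simp: S_def)
    finally show ?thesis by (simp add: b_def Suc mult_ac)
  qed
  have "summable (\<lambda>n. b (Suc n))"
    using summable_mult[OF summable_exp_generic[of "R * norm A"], of "norm A"]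
    by (simp add: b_def del: summable_cmult_iff)
  then have summ: "summable b" by (simp only: summable_Suc_iff)
  have ul: "uniform_limit S (\<lambda>n s. \<Sum>i<n. d i s) (\<lambda>s. \<Sum>i. d i s) sequentially"
    by (rule Weierstrass_m_test[OF _ summ]) (rule bound)
  have sum_d: "(\<Sum>i. d i s) = op_exp s A o\<^sub>L A" if "s \<in> S" for s
  proof -
    have "summable (\<lambda>i. d i s)"
      by (rule summable_comparison_test'[OF summ]) (rule bound[OF that])
    then have "(\<Sum>i. d i s) = (\<Sum>i. d (Suc i) s)"
      using suminf_split_head[of "\<lambda>i. d i s"] by (simp add: d_def)
    also have "\<dots> = op_exp s A o\<^sub>L A"
      unfolding dSuc op_exp_def
      by (rule bounded_linear.suminf[OF bounded_bilinear.bounded_linear_left[OF bounded_bilinear_blinfun_compose] summable_op_exp, symmetric])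
    finally show ?thesis .
  qed
  have "\<exists>g. \<forall>s\<in>S. (\<lambda>n. (s ^ n / fact n) *\<^sub>R op_pow A n) sums g s \<and>
      (g has_derivative (\<lambda>h. h *\<^sub>R (op_exp s A o\<^sub>L A))) (at s within S)"
  proof (rule has_derivative_series[where f = "\<lambda>n s. (s ^ n / fact n) *\<^sub>R op_pow A n"
        and f' = "\<lambda>n s h. h *\<^sub>R d n s" and x = 0 and l = "op_exp 0 A"])
    show "convex S" by (simp add: S_def)
    show "((\<lambda>s. (s ^ n / fact n) *\<^sub>R op_pow A n) has_derivative (\<lambda>h. h *\<^sub>R d n s)) (at s within S)" for n s
      unfolding d_def by (auto intro!: derivative_eq_intros simp: fun_eq_iff field_simps)
    show "0 \<in> S" by (simp add: S_def R_def add_nonneg_pos)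
    show "(\<lambda>n. (0 ^ n / fact n) *\<^sub>R op_pow A n) sums op_exp 0 A"
      unfolding op_exp_def by (rule summable_sums[OF summable_op_exp])
    fix e :: real assume "e > 0"
    with ul have "\<forall>\<^sub>F n in sequentially. \<forall>s\<in>S. dist (\<Sum>i<n. d i s) (\<Sum>i. d i s) < e"
      unfolding uniform_limit_iff by blast
    then show "\<forall>\<^sub>F n in sequentially. \<forall>s\<in>S. \<forall>h.
        norm ((\<Sum>i<n. h *\<^sub>R d i s) - h *\<^sub>R (op_exp s A o\<^sub>L A)) \<le> e * norm h"
    proof eventually_elim
      case (elim n)
      show ?case
      proof (intro ballI allI)
        fix s h assume s: "s \<in> S"
        have "norm ((\<Sum>i<n. h *\<^sub>R d i s) - h *\<^sub>R (op_exp s A o\<^sub>L A)) =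
            \<bar>h\<bar> * norm ((\<Sum>i<n. d i s) - (\<Sum>i. d i s))"
          by (simp add: sum_d[OF s] scaleR_sum_right[symmetric] scaleR_diff_right[symmetric])
        also have "\<dots> \<le> \<bar>h\<bar> * e"
          using elim s by (intro mult_left_mono) (auto simp: dist_norm intro: less_imp_le)
        finally show "norm ((\<Sum>i<n. h *\<^sub>R d i s) - h *\<^sub>R (op_exp s A o\<^sub>L A)) \<le> e * norm h"
          by (simp add: mult.commute)
      qed
    qed
  qed
  then obtain g where g: "\<And>s. s \<in> S \<Longrightarrow> (\<lambda>n. (s ^ n / fact n) *\<^sub>R op_pow A n) sums g s"
    "\<And>s. s \<in> S \<Longrightarrow> (g has_derivative (\<lambda>h. h *\<^sub>R (op_exp s A o\<^sub>L A))) (at s within S)" by blast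
  have t: "t \<in> S" "open S" by (auto simp: S_def R_def)
  have "g s = op_exp s A" if "s \<in> S" for s
    using g(1)[OF that] unfolding op_exp_def by (rule sums_unique)
  then have "((\<lambda>s. op_exp s A) has_derivative (\<lambda>h. h *\<^sub>R (op_exp t A o\<^sub>L A))) (at t within S)"
    using g(2)[OF t(1)] t(1) by (metis has_derivative_transform)
  then show ?thesis
    using at_within_open[OF t] by (simp add: has_vector_derivative_def)
qed

text \<open>Finiteness has to be assumed separately, since \<open>real_of_ereal\<close> sends
  infinite values to 0. Zeros of \<open>N\<close> are treated apart, because \<open>ln 0 = 0\<close>
  does not reflect their size.\<close>

lemma Limsup_growth_bound:
  fixes N :: "real \<Rightarrow> real"
  assumes fin: "\<bar>Limsup at_top (\<lambda>t. ereal (ln (N t) / t))\<bar> \<noteq> \<infinity>"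
    and c: "real_of_ereal (Limsup at_top (\<lambda>t. ereal (ln (N t) / t))) < c"
    and N: "\<And>t. N t \<ge> 0"
  shows "\<forall>\<^sub>F t in at_top. N t \<le> exp (c * t)"
proof -
  have "Limsup at_top (\<lambda>t. ereal (ln (N t) / t)) =
      ereal (real_of_ereal (Limsup at_top (\<lambda>t. ereal (ln (N t) / t))))"
    by (rule ereal_real'[OF fin, symmetric])
  also have "\<dots> < ereal c" using c by simp
  finally have "\<forall>\<^sub>F t in at_top. ereal (ln (N t) / t) < ereal c" by (rule Limsup_lessD)
  with eventually_gt_at_top[of 0] show ?thesis
  proof eventually_elim
    case (elim t)
    show ?case
    proof (cases "N t = 0")
      case False
      then have "N t > 0" using N[of t] by linarith
      moreover have "ln (N t) \<le> c * t" using elim by (simp add: field_simps)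
      ultimately show ?thesis by (metis exp_le_cancel_iff exp_ln)
    qed simp
  qed
qed

text \<open>An infinite limsup would be read as 0, so a negative value can only come from a finite
  limsup.\<close>

lemma kappa_plus_op_bound:
  assumes "kappa_plus_op A < 0" "kappa_plus_op A < c"
  shows "\<forall>\<^sub>F t in at_top. norm (op_exp t A) \<le> exp (c * t)"
proof (rule Limsup_growth_bound)
  show "\<bar>Limsup at_top (\<lambda>t. ereal (ln (norm (op_exp t A)) / t))\<bar> \<noteq> \<infinity>"
    using assms(1) unfolding kappa_plus_op_def by auto
qed (use assms(2) in \<open>auto simp: kappa_plus_op_def\<close>)

text \<open>Here no sign of \<open>kappa_plus a\<close> is known, and finiteness of the limsup is
  proved: the upper bound is the norm of the exponential series, the lower one follows from
  \<open>exp (t *\<^sub>R a)\<close> times its inverse being 1.\<close>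

lemma kappa_plus_bound:
  fixes a :: "'b::{real_normed_algebra_1,banach}"
  assumes c: "kappa_plus a < c"
  shows "\<forall>\<^sub>F t in at_top. norm (exp (t *\<^sub>R a)) \<le> exp (c * t)"
proof (rule Limsup_growth_bound)
  let ?L = "Limsup at_top (\<lambda>t. ereal (ln (norm (exp (t *\<^sub>R a))) / t))"
  have bounds: "- norm a \<le> ln (norm (exp (t *\<^sub>R a))) / t \<and> ln (norm (exp (t *\<^sub>R a))) / t \<le> norm a"
    if t: "t > 0" for t
  proof -
    have le: "norm (exp (t *\<^sub>R a)) \<le> exp (t * norm a)" "norm (exp (- (t *\<^sub>R a))) \<le> exp (t * norm a)"
      using norm_exp[of "t *\<^sub>R a"] norm_exp[of "- (t *\<^sub>R a)"] t by auto
    have "1 = norm (exp (t *\<^sub>R a) * exp (- (t *\<^sub>R a)))" by (simp add: exp_minus_inverse)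
    also have "\<dots> \<le> norm (exp (t *\<^sub>R a)) * norm (exp (- (t *\<^sub>R a)))" by (rule norm_mult_ineq)
    also have "\<dots> \<le> norm (exp (t *\<^sub>R a)) * exp (t * norm a)"
      by (intro mult_left_mono le) simp
    finally have "exp (- (t * norm a)) \<le> norm (exp (t *\<^sub>R a))"
      by (simp add: exp_minus field_simps)
    moreover from this have pos: "norm (exp (t *\<^sub>R a)) > 0"
      using exp_gt_zero less_le_trans by blast
    ultimately have "- (t * norm a) \<le> ln (norm (exp (t *\<^sub>R a)))" by (simp add: ln_ge_iff)
    moreover have "ln (norm (exp (t *\<^sub>R a))) \<le> t * norm a"
      using le(1) pos by (metis exp_gt_zero ln_exp ln_le_cancel_iff)
    ultimately show ?thesis using t by (simp add: field_simps)
  qed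
  have "\<forall>\<^sub>F t in at_top. ereal (ln (norm (exp (t *\<^sub>R a))) / t) \<le> ereal (norm a)"
    using eventually_gt_at_top[of 0] by eventually_elim (use bounds in simp)
  then have "?L \<le> ereal (norm a)" by (rule Limsup_bounded)
  moreover have "\<forall>\<^sub>F t in at_top. ereal (- norm a) \<le> ereal (ln (norm (exp (t *\<^sub>R a))) / t)"
    using eventually_gt_at_top[of 0] by eventually_elim (use bounds in simp)
  then have "ereal (- norm a) \<le> ?L" by (intro le_Limsup) simp_all
  ultimately show "\<bar>?L\<bar> \<noteq> \<infinity>" by auto
qed (use c in \<open>auto simp: kappa_plus_def\<close>)

lemma kappa_minus_bound:
  fixes a :: "'b::{real_normed_algebra_1,banach}"
  assumes c: "- kappa_minus a < c"
  shows "\<forall>\<^sub>F t in at_top. norm (exp (- (t *\<^sub>R a))) \<le> exp (c * t)"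
  using kappa_plus_bound[of "- a" c] c by (simp add: kappa_plus_def kappa_minus_def)

section \<open>Semigroups attracted to a fixed point\<close>

locale attracted_semigroup =
  fixes D :: "'a::{complex_normed_vector,banach} set"
    and \<rho> :: "'a \<Rightarrow> 'a \<Rightarrow> real"
    and F :: "real \<Rightarrow> 'a \<Rightarrow> 'a"
    and x0 :: 'a
  assumes D_open: "open D" and D_bdd: "bounded D"
    and hyp: "hyperbolic_metric D \<rho>"
    and F_holo: "\<And>t. t \<ge> 0 \<Longrightarrow> holo_on D (F t)"
    and F_self: "\<And>t. t \<ge> 0 \<Longrightarrow> F t ` D \<subseteq> D"
    and F_semigroup: "\<And>t s x. t \<ge> 0 \<Longrightarrow> s \<ge> 0 \<Longrightarrow> x \<in> D \<Longrightarrow> F (t + s) x = F t (F s x)"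
    and F_cont0: "\<And>x. x \<in> D \<Longrightarrow> ((\<lambda>t. F t x) \<longlongrightarrow> x) (at_right 0)"
    and x0_in: "x0 \<in> D"
    and F_conv: "\<And>S. strictly_inside D S \<Longrightarrow> uniform_limit S F (\<lambda>_. x0) at_top"
begin

text \<open>The centre is \<open>x0\<close> because a common fixed point makes the ball forward
  invariant under the whole semigroup.\<close>

definition rball :: "real \<Rightarrow> 'a set" where
  "rball R = {y \<in> D. \<rho> x0 y \<le> R}"

lemma rho_triangle: "x \<in> D \<Longrightarrow> y \<in> D \<Longrightarrow> z \<in> D \<Longrightarrow> \<rho> x z \<le> \<rho> x y + \<rho> y z"
  using hyp unfolding hyperbolic_metric_def by (elim conjE) simp

lemma rho_nonexpansive:
  "holo_on D g \<Longrightarrow> g ` D \<subseteq> D \<Longrightarrow> x \<in> D \<Longrightarrow> y \<in> D \<Longrightarrow> \<rho> (g x) (g y) \<le> \<rho> x y"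
  using hyp unfolding hyperbolic_metric_def by (elim conjE) simp

lemma strictly_inside_iff_rho:
  "S \<subseteq> D \<Longrightarrow> strictly_inside D S \<longleftrightarrow> (\<exists>c\<in>D. \<exists>r. \<forall>y\<in>S. \<rho> c y \<le> r)"
  using hyp unfolding hyperbolic_metric_def by (elim conjE) simp

lemma F_in: "t \<ge> 0 \<Longrightarrow> x \<in> D \<Longrightarrow> F t x \<in> D"
  using F_self by blast

text \<open>Only the limit at 0 from the right is given. The semigroup law identifies
  \<open>F t (F 0 x)\<close> with \<open>F t x\<close>, and \<open>t\<close> tends to 0 on both
  sides.\<close>

lemma F_0: assumes x: "x \<in> D" shows "F 0 x = x"
proof -
  have "((\<lambda>t. F t (F 0 x)) \<longlongrightarrow> F 0 x) (at_right 0)"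
    using F_cont0 F_in x by simp
  moreover have "\<forall>\<^sub>F t in at_right 0. F t (F 0 x) = F t x"
    using eventually_at_right_less[of 0]
  proof eventually_elim
    case (elim t)
    then show ?case using F_semigroup[of t 0 x, symmetric] x by simp
  qed
  ultimately have "((\<lambda>t. F t x) \<longlongrightarrow> F 0 x) (at_right 0)"
    by (rule Lim_transform_eventually)
  then show ?thesis by (rule tendsto_unique[OF trivial_limit_at_right_real _ F_cont0[OF x]])
qed

lemma ball_strictly_inside:
  assumes "x \<in> D"
  obtains \<delta> where "\<delta> > 0" "ball x \<delta> \<subseteq> D" "strictly_inside D (ball x \<delta>)"
proof -
  obtain e where e: "e > 0" "ball x e \<subseteq> D" using D_open assms openE by blast
  have far: "e \<le> dist x z" if "z \<in> frontier D" for z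
    using that e(2) D_open by (force simp: frontier_def interior_open)
  have sub: "ball x (e / 2) \<subseteq> D" using e by auto
  have "e / 2 \<le> dist y z" if "y \<in> ball x (e / 2)" "z \<in> frontier D" for y z
    using far[OF that(2)] that(1) dist_triangle[of x z y] by simp
  then have "strictly_inside D (ball x (e / 2))"
    unfolding strictly_inside_def using sub e(1) by (intro conjI exI[of _ "e / 2"]) auto
  with sub e(1) show ?thesis by (intro that[of "e / 2"]) auto
qed

lemma rball_subset: "rball R \<subseteq> D"
  by (auto simp: rball_def)

lemma rball_strictly_inside: "strictly_inside D (rball R)"
  unfolding strictly_inside_iff_rho[OF rball_subset] using x0_in by (auto simp: rball_def)

text \<open>A small ball lies in some \<open>\<rho>\<close>-ball of unknown centre; the triangle
  inequality recentres it at \<open>x0\<close>. Every point thus has a norm neighbourhood in one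
  invariant set.\<close>

lemma ball_in_rball:
  assumes x: "x \<in> D"
  obtains \<delta> R where "\<delta> > 0" "ball x \<delta> \<subseteq> rball R"
proof -
  obtain \<delta> where \<delta>: "\<delta> > 0" "ball x \<delta> \<subseteq> D" "strictly_inside D (ball x \<delta>)"
    using ball_strictly_inside[OF x] .
  then obtain c r where c: "c \<in> D" "\<And>y. y \<in> ball x \<delta> \<Longrightarrow> \<rho> c y \<le> r"
    unfolding strictly_inside_iff_rho[OF \<delta>(2)] by blast
  have "ball x \<delta> \<subseteq> rball (\<rho> x0 c + r)"
  proof
    fix y assume y: "y \<in> ball x \<delta>"
    then have "y \<in> D" using \<delta> by blast
    then show "y \<in> rball (\<rho> x0 c + r)"
      using rho_triangle[OF x0_in c(1), of y] c(2)[OF y] by (simp add: rball_def)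
  qed
  with \<delta>(1) show ?thesis by (rule that)
qed

text \<open>By continuity \<open>F t (F s x0)\<close> tends to \<open>F t x0\<close>, and as
  \<open>F (t + s) x0\<close> it tends to \<open>x0\<close>.\<close>

lemma F_fixed: assumes t: "t \<ge> 0" shows "F t x0 = x0"
proof -
  obtain \<delta> where \<delta>: "\<delta> > 0" "strictly_inside D (ball x0 \<delta>)"
    using ball_strictly_inside[OF x0_in] .
  have lim: "((\<lambda>s. F s x0) \<longlongrightarrow> x0) at_top"
    using tendsto_uniform_limitI[OF F_conv[OF \<delta>(2)], of x0] \<delta>(1) by simp
  have "isCont (F t) x0" using holo_on_imp_isCont[OF F_holo[OF t] x0_in] .
  then have "((\<lambda>s. F t (F s x0)) \<longlongrightarrow> F t x0) at_top"
    using lim by (rule isCont_tendsto_compose)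
  moreover have "\<forall>\<^sub>F s in at_top. F t (F s x0) = F (t + s) x0"
    using eventually_ge_at_top[of 0] by eventually_elim (use F_semigroup t x0_in in simp)
  ultimately have "((\<lambda>s. F (t + s) x0) \<longlongrightarrow> F t x0) at_top"
    by (rule Lim_transform_eventually)
  moreover have "((\<lambda>s. F (t + s) x0) \<longlongrightarrow> x0) at_top"
    using lim filterlim_tendsto_add_at_top[OF tendsto_const filterlim_ident]
    by (rule filterlim_compose)
  ultimately show ?thesis by (intro tendsto_unique[of at_top]) simp_all
qed

lemma F_rball: assumes t: "t \<ge> 0" and x: "x \<in> rball R" shows "F t x \<in> rball R"
proof -
  have xD: "x \<in> D" using x by (simp add: rball_def)
  have "\<rho> (F t x0) (F t x) \<le> \<rho> x0 x"
    using rho_nonexpansive[OF F_holo[OF t] F_self[OF t] x0_in xD] .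
  then show ?thesis using x F_fixed[OF t] F_in[OF t xD] by (simp add: rball_def)
qed

lemma D_diam: obtains K where "K > 0" "\<And>x y. x \<in> D \<Longrightarrow> y \<in> D \<Longrightarrow> norm (x - y) \<le> K"
proof -
  obtain b where b: "b > 0" "\<And>x. x \<in> D \<Longrightarrow> norm x \<le> b"
    using D_bdd unfolding bounded_pos by blast
  have "norm (x - y) \<le> 2 * b" if "x \<in> D" "y \<in> D" for x y
    using norm_triangle_ineq4[of x y] b(2)[OF that(1)] b(2)[OF that(2)] by linarith
  with b(1) show ?thesis by (intro that[of "2 * b"]) auto
qed

text \<open>All \<open>F t\<close> take values in \<open>D\<close>, so Schwarz' lemma applies with
  the diameter bound of \<open>D\<close>, which does not involve \<open>t\<close>.\<close>

lemma F_lipschitz_at_fixed: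
  obtains r C where "r > 0" "C > 0" "ball x0 r \<subseteq> D"
    "\<And>t x. t \<ge> 0 \<Longrightarrow> x \<in> ball x0 r \<Longrightarrow> norm (F t x - x0) \<le> C * norm (x - x0)"
proof -
  obtain r where r: "r > 0" "ball x0 r \<subseteq> D" using D_open x0_in openE by blast
  obtain K where K: "K > 0" "\<And>x y. x \<in> D \<Longrightarrow> y \<in> D \<Longrightarrow> norm (x - y) \<le> K" by (rule D_diam) blast
  have "norm (F t x - x0) \<le> K / r * norm (x - x0)" if "t \<ge> 0" "x \<in> ball x0 r" for t x
  proof -
    have "norm (F t x - F t x0) \<le> K / r * norm (x - x0)"
      using holo_on_subset[OF F_holo[OF that(1)] r(2)] _ that(2)
    proof (rule holo_on_schwarz)
      show "norm (F t y - F t x0) \<le> K" if "y \<in> ball x0 r" for y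
        using K(2) F_in[OF \<open>t \<ge> 0\<close>] x0_in that r(2) by blast
    qed
    then show ?thesis using F_fixed[OF that(1)] by simp
  qed
  with r K(1) show ?thesis by (intro that[of r "K / r"]) auto
qed

end

locale generated_semigroup = attracted_semigroup D \<rho> F x0
  for D :: "'a::{complex_normed_vector,banach} set" and \<rho> F x0 +
  fixes f :: "'a \<Rightarrow> 'a" and A :: "'a \<Rightarrow>\<^sub>L 'a"
  assumes f_holo: "holo_on D f"
    and f_gen: "\<And>S. strictly_inside D S \<Longrightarrow>
                  uniform_limit S (\<lambda>t x. (1 / t) *\<^sub>R (F t x - x)) f (at_right 0)"
    and A_deriv: "(f has_derivative blinfun_apply A) (at x0)"
    and A_stable: "kappa_plus_op A < 0"
begin

section \<open>Orbits as solutions of the differential equation given by the generator\<close>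

lemma generator_uniform:
  assumes e: "e > 0"
  obtains d where "d > 0" "\<And>h y. 0 < h \<Longrightarrow> h < d \<Longrightarrow> y \<in> rball R \<Longrightarrow> norm (F h y - y - h *\<^sub>R f y) \<le> e * h"
proof -
  have "\<forall>\<^sub>F h in at_right 0. \<forall>y\<in>rball R. dist ((1 / h) *\<^sub>R (F h y - y)) (f y) < e"
    using f_gen[OF rball_strictly_inside] e unfolding uniform_limit_iff by blast
  then obtain d where d: "d > 0"
    "\<And>h y. 0 < h \<Longrightarrow> h < d \<Longrightarrow> y \<in> rball R \<Longrightarrow> dist ((1 / h) *\<^sub>R (F h y - y)) (f y) < e"
    unfolding eventually_at_right_field by blast
  have "norm (F h y - y - h *\<^sub>R f y) \<le> e * h" if h: "0 < h" "h < d" "y \<in> rball R" for h y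
  proof -
    have "F h y - y - h *\<^sub>R f y = h *\<^sub>R ((1 / h) *\<^sub>R (F h y - y) - f y)"
      using h(1) by (simp add: scaleR_diff_right)
    then have "norm (F h y - y - h *\<^sub>R f y) = h * norm ((1 / h) *\<^sub>R (F h y - y) - f y)"
      using h(1) by simp
    also have "\<dots> \<le> h * e" using d(2)[OF h] h(1) by (intro mult_left_mono) (auto simp: dist_norm)
    finally show ?thesis by (simp add: mult.commute)
  qed
  with d(1) show ?thesis by (rule that)
qed

lemma f_x0: "f x0 = 0"
proof -
  obtain \<delta> R where "\<delta> > 0" "ball x0 \<delta> \<subseteq> rball R" using ball_in_rball[OF x0_in] .
  then have x0: "x0 \<in> rball R" by auto
  have "norm (f x0) \<le> e" if e: "e > 0" for e
  proof -
    obtain d where d: "d > 0"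
      "\<And>h y. 0 < h \<Longrightarrow> h < d \<Longrightarrow> y \<in> rball R \<Longrightarrow> norm (F h y - y - h *\<^sub>R f y) \<le> e * h"
      using generator_uniform[OF e] by blast
    have "norm (F (d/2) x0 - x0 - (d/2) *\<^sub>R f x0) \<le> e * (d/2)"
      using d(2)[of "d/2" x0] d(1) x0 by simp
    then show ?thesis using F_fixed[of "d/2"] d(1) by simp
  qed
  then have "norm (f x0) \<le> 0" by (rule field_le_epsilon) simp
  then show ?thesis by simp
qed

lemma F_time_lipschitz:
  obtains d L where "d > 0" "L > 0"
    "\<And>h y. 0 \<le> h \<Longrightarrow> h < d \<Longrightarrow> y \<in> rball R \<Longrightarrow> norm (F h y - y) \<le> L * h"
proof -
  obtain d where d: "d > 0"
    "\<And>h y. 0 < h \<Longrightarrow> h < d \<Longrightarrow> y \<in> rball R \<Longrightarrow> norm (F h y - y - h *\<^sub>R f y) \<le> 1 * h"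
    using generator_uniform[of 1] by auto
  obtain K where K: "K > 0" "\<And>x y. x \<in> D \<Longrightarrow> y \<in> D \<Longrightarrow> norm (x - y) \<le> K" by (rule D_diam) blast
  \<comment> \<open>A difference quotient at the single time \<open>c\<close> bounds
    \<open>f\<close> on \<open>rball R\<close>: its numerator is at most the diameter bound
    \<open>K\<close>, and its distance from \<open>f\<close> is at most 1.\<close>
  define c where "c = d / 2"
  have c: "c > 0" "c < d" using d(1) by (auto simp: c_def)
  have f_bound: "norm (f y) \<le> K / c + 1" if y: "y \<in> rball R" for y
  proof -
    have yD: "y \<in> D" using y rball_subset by blast
    have "norm (c *\<^sub>R f y) \<le> norm (F c y - y) + norm (F c y - y - c *\<^sub>R f y)"
      using norm_triangle_ineq4[of "F c y - y" "F c y - y - c *\<^sub>R f y"] by simp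
    also have "\<dots> \<le> K + 1 * c"
      using K(2) F_in yD c d(2)[OF c y] by (intro add_mono) auto
    finally show ?thesis using c(1) by (simp add: field_simps)
  qed
  have "norm (F h y - y) \<le> (K / c + 2) * h" if h: "0 \<le> h" "h < d" "y \<in> rball R" for h y
  proof (cases "h = 0")
    case True
    then show ?thesis using F_0 h(3) rball_subset by auto
  next
    case False
    then have h0: "h > 0" using h by simp
    have "norm (F h y - y) \<le> norm (F h y - y - h *\<^sub>R f y) + norm (h *\<^sub>R f y)"
      using norm_triangle_ineq[of "F h y - y - h *\<^sub>R f y" "h *\<^sub>R f y"] by simp
    also have "\<dots> \<le> 1 * h + h * (K / c + 1)"
      using d(2)[OF h0 h(2,3)] f_bound[OF h(3)] h0 by (intro add_mono) auto
    finally show ?thesis by (simp add: algebra_simps)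
  qed
  moreover have "K / c + 2 > 0" using K c by (simp add: add_pos_pos)
  ultimately show ?thesis using that[OF d(1)] by blast
qed

text \<open>The generator a priori only yields right derivatives. Left derivatives come from the uniformity
  of the limit on the invariant set \<open>rball R\<close>.\<close>

lemma F_has_vector_derivative:
  assumes x: "x \<in> D" and t: "t \<ge> 0"
  shows "((\<lambda>s. F s x) has_vector_derivative f (F t x)) (at t within {0..})"
proof -
  obtain \<delta> R where "\<delta> > 0" "ball x \<delta> \<subseteq> rball R" using ball_in_rball[OF x] .
  then have xR: "x \<in> rball R" by auto
  then have orbit: "F s x \<in> rball R" if "s \<ge> 0" for s using F_rball that by blast
  have split: "F s x = F (s - r) (F r x)" if "0 \<le> r" "r \<le> s" for s r
    using F_semigroup[of "s - r" r x] that x by simp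
  obtain d0 L where d0: "d0 > 0" and L: "L > 0"
    "\<And>h y. 0 \<le> h \<Longrightarrow> h < d0 \<Longrightarrow> y \<in> rball R \<Longrightarrow> norm (F h y - y) \<le> L * h"
    using F_time_lipschitz[of R] by metis
  have lip: "norm (F s x - F t x) \<le> L * \<bar>s - t\<bar>" if "s \<ge> 0" "\<bar>s - t\<bar> < d0" for s
  proof (cases "s \<ge> t")
    case True
    then show ?thesis using L(2)[of "s - t" "F t x"] split[of t s] t that orbit by simp
  next
    case False
    then show ?thesis using L(2)[of "t - s" "F s x"] split[of s t] that orbit
      by (simp add: norm_minus_commute)
  qed
  show ?thesis
    unfolding has_vector_derivative_def has_derivative_within_alt
  proof (intro conjI allI impI)
    show "bounded_linear (\<lambda>h. h *\<^sub>R f (F t x))" by (rule bounded_linear_scaleR_left)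
    fix e :: real assume e: "e > 0"
    then have e2: "e / 2 > 0" by simp
    obtain d1 where d1: "d1 > 0"
      "\<And>h y. 0 < h \<Longrightarrow> h < d1 \<Longrightarrow> y \<in> rball R \<Longrightarrow> norm (F h y - y - h *\<^sub>R f y) \<le> e / 2 * h"
      using generator_uniform[OF e2] by blast
    have "isCont f (F t x)" using holo_on_imp_isCont[OF f_holo F_in[OF t x]] .
    then obtain \<eta> where \<eta>: "\<eta> > 0" "\<And>y. norm (y - F t x) < \<eta> \<Longrightarrow> norm (f y - f (F t x)) < e / 2"
      using e2 unfolding continuous_at_eps_delta dist_norm by blast
    \<comment> \<open>Below \<open>d0\<close> the orbit is Lipschitz in time, below
      \<open>d1\<close> the generator estimate holds, and below \<open>\<eta> / L\<close> the orbit
      stays where \<open>f\<close> differs from \<open>f (F t x)\<close> by less than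
      \<open>e / 2\<close>.\<close>
    define d where "d = min (min d0 d1) (\<eta> / L)"
    have d: "d > 0" using d0 d1 \<eta> L by (simp add: d_def)
    show "\<exists>d>0. \<forall>s\<in>{0..}. norm (s - t) < d \<longrightarrow>
        norm (F s x - F t x - (s - t) *\<^sub>R f (F t x)) \<le> e * norm (s - t)"
    proof (intro exI[of _ d] conjI d ballI impI)
      fix s :: real assume "s \<in> {0..}" and "norm (s - t) < d"
      then have s: "s \<ge> 0" "\<bar>s - t\<bar> < d0" "\<bar>s - t\<bar> < d1" "L * \<bar>s - t\<bar> < \<eta>"
        using L(1) by (auto simp: d_def field_simps)
      consider "s = t" | "s > t" | "s < t" by linarith
      then show "norm (F s x - F t x - (s - t) *\<^sub>R f (F t x)) \<le> e * norm (s - t)"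
      proof cases
        case 2
        then have "norm (F s x - F t x - (s - t) *\<^sub>R f (F t x)) \<le> e / 2 * (s - t)"
          using d1(2)[of "s - t" "F t x"] s split[of t s] t orbit by simp
        also have "\<dots> \<le> e * (s - t)" using 2 e by (intro mult_right_mono) auto
        finally show ?thesis using 2 by simp
      next
        case 3
        \<comment> \<open>The forward estimate is started at the earlier point \<open>F s x\<close>;
          replacing \<open>f (F s x)\<close> by \<open>f (F t x)\<close> costs the second half of
          \<open>e\<close>.\<close>
        have 1: "norm (F t x - F s x - (t - s) *\<^sub>R f (F s x)) \<le> e / 2 * (t - s)"
          using d1(2)[of "t - s" "F s x"] 3 s split[of s t] orbit by simp
        have "norm (f (F s x) - f (F t x)) \<le> e / 2"
          using lip[OF s(1,2)] s(4) \<eta>(2)[of "F s x"] by fastforce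
        then have 2: "norm ((t - s) *\<^sub>R (f (F s x) - f (F t x))) \<le> e / 2 * (t - s)"
          using 3 by (simp add: mult.commute)
        have "F s x - F t x - (s - t) *\<^sub>R f (F t x) =
            - ((F t x - F s x - (t - s) *\<^sub>R f (F s x)) + (t - s) *\<^sub>R (f (F s x) - f (F t x)))"
          by (simp add: algebra_simps)
        then have "norm (F s x - F t x - (s - t) *\<^sub>R f (F t x)) \<le>
            norm (F t x - F s x - (t - s) *\<^sub>R f (F s x)) + norm ((t - s) *\<^sub>R (f (F s x) - f (F t x)))"
          by (metis norm_minus_cancel norm_triangle_ineq)
        also have "\<dots> \<le> e / 2 * (t - s) + e / 2 * (t - s)" using 1 2 by (rule add_mono)
        also have "\<dots> = e * norm (s - t)" using 3 by simp
        finally show ?thesis .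
      qed simp
    qed
  qed
qed

end

section \<open>Exponential decay of the semigroup towards its fixed point\<close>

context generated_semigroup
begin

text \<open>Variation of constants: \<open>op_exp (T - s) A (F s x - x0)\<close> runs from
  \<open>op_exp T A (x - x0)\<close> at \<open>s = 0\<close> to \<open>F T x - x0\<close> at
  \<open>s = T\<close>. Its derivative contains only the remainder of \<open>f\<close> after
  linearization at \<open>x0\<close>.\<close>

lemma F_linearization:
  assumes T: "T > 0" and e: "e > 0"
  obtains \<delta> where "\<delta> > 0"
    "\<And>x. x \<in> ball x0 \<delta> \<Longrightarrow> norm (F T x - x0 - op_exp T A (x - x0)) \<le> e * norm (x - x0)"
proof -
  obtain r C where r: "r > 0" "C > 0" "ball x0 r \<subseteq> D"
    and C: "\<And>t x. t \<ge> 0 \<Longrightarrow> x \<in> ball x0 r \<Longrightarrow> norm (F t x - x0) \<le> C * norm (x - x0)"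
    using F_lipschitz_at_fixed by metis
  \<comment> \<open>\<open>b\<close> collects the bound of the exponential, the Lipschitz constant
    and the length of the interval, so that a remainder of relative size \<open>e / b\<close> adds
    up to \<open>e\<close>.\<close>
  define b where "b = exp (T * norm A) * C * T"
  have b: "b > 0" using r T by (simp add: b_def)
  have "e / b > 0" using e b by simp
  then obtain d where d: "d > 0"
    "\<And>y. norm (y - x0) < d \<Longrightarrow> norm (f y - f x0 - A (y - x0)) \<le> e / b * norm (y - x0)"
    using A_deriv unfolding has_derivative_at_alt by blast
  \<comment> \<open>The radius \<open>d / C\<close> keeps the entire orbit within distance
    \<open>d\<close> of \<open>x0\<close>.\<close>
  define \<delta> where "\<delta> = min r (d / C)"
  have "norm (F T x - x0 - op_exp T A (x - x0)) \<le> e * norm (x - x0)" if x: "x \<in> ball x0 \<delta>" for x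
  proof -
    define n where "n = norm (x - x0)"
    have xr: "x \<in> ball x0 r" and nd: "C * n < d"
      using x r by (auto simp: \<delta>_def n_def dist_norm norm_minus_commute field_simps)
    then have xD: "x \<in> D" using r by blast
    define w where "w s = op_exp (T - s) A (F s x - x0)" for s
    define w' where "w' s = op_exp (T - s) A (f (F s x)) - op_exp (T - s) A (A (F s x - x0))" for s
    have E: "((\<lambda>s. op_exp (T - s) A) has_vector_derivative - (op_exp (T - s) A o\<^sub>L A)) (at s within {0..})" for s
    proof -
      have "((\<lambda>s. T - s) has_vector_derivative - 1) (at s within {0..})"
        by (auto intro!: derivative_eq_intros)
      from vector_diff_chain_within[OF this has_vector_derivative_at_within[OF op_exp_has_vector_derivative]]
      show ?thesis by (simp add: o_def)
    qed
    have der: "(w has_vector_derivative w' s) (at s within {0..})" if "s \<ge> 0" for s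
    proof -
      have "((\<lambda>s. F s x - x0) has_vector_derivative f (F s x)) (at s within {0..})"
        using has_vector_derivative_diff[OF F_has_vector_derivative[OF xD that] has_vector_derivative_const] by simp
      from bounded_bilinear.has_vector_derivative[OF bounded_bilinear_blinfun_apply E this]
      show ?thesis unfolding w_def w'_def by (simp add: blinfun.minus_left)
    qed
    have bnd: "norm (w' s) \<le> exp (T * norm A) * (e / b * (C * n))" if s: "0 < s" "s < T" for s
    proof -
      have y: "norm (F s x - x0) \<le> C * n" using C[of s x] s xr by (simp add: n_def)
      have "w' s = op_exp (T - s) A (f (F s x) - f x0 - A (F s x - x0))"
        by (simp add: w'_def f_x0 blinfun.diff_right)
      then have "norm (w' s) \<le> norm (op_exp (T - s) A) * norm (f (F s x) - f x0 - A (F s x - x0))"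
        by (metis norm_blinfun)
      also have "\<dots> \<le> exp (T * norm A) * (e / b * (C * n))"
      proof (rule mult_mono)
        have "norm (op_exp (T - s) A) \<le> exp (\<bar>T - s\<bar> * norm A)" by (rule norm_op_exp_le)
        also have "\<dots> \<le> exp (T * norm A)" using s by (simp add: mult_right_mono)
        finally show "norm (op_exp (T - s) A) \<le> exp (T * norm A)" .
        have "norm (f (F s x) - f x0 - A (F s x - x0)) \<le> e / b * norm (F s x - x0)"
          using d(2) y nd by simp
        also have "\<dots> \<le> e / b * (C * n)" using y \<open>e / b > 0\<close> by (intro mult_left_mono) auto
        finally show "norm (f (F s x) - f x0 - A (F s x - x0)) \<le> e / b * (C * n)" .
      qed auto
      finally show ?thesis .
    qed
    have "norm (w T - w 0) \<le> exp (T * norm A) * (e / b * (C * n)) * T - exp (T * norm A) * (e / b * (C * n)) * 0"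
    proof (rule differentiable_bound_general[OF T])
      show "continuous_on {0..T} w"
        by (rule continuous_on_subset[OF continuous_on_vector_derivative[of "{0..}" w w']])
          (use der in auto)
      show "(w has_vector_derivative w' s) (at s)" if "0 < s" "s < T" for s
      proof -
        have "s \<in> interior {0..}" using that by simp
        then show ?thesis using der[of s] that at_within_interior by (metis less_imp_le)
      qed
      show "((\<lambda>s. exp (T * norm A) * (e / b * (C * n)) * s) has_vector_derivative
          exp (T * norm A) * (e / b * (C * n))) (at s)" if "0 < s" "s < T" for s
        by (auto intro!: derivative_eq_intros)
      show "continuous_on {0..T} (\<lambda>s. exp (T * norm A) * (e / b * (C * n)) * s)"
        by (intro continuous_on_mult continuous_on_const continuous_on_id)
    qed (rule bnd)
    also have "\<dots> = e * n" using b T r by (simp add: b_def)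
    finally show ?thesis by (simp add: w_def n_def F_0[OF xD])
  qed
  moreover have "\<delta> > 0" using r d by (simp add: \<delta>_def)
  ultimately show ?thesis using that by blast
qed

text \<open>A rate \<open>a'\<close> between \<open>a\<close> and \<open>- kappa_plus_op A\<close>
  is used for the linear flow. At a suitable time \<open>T\<close> the gap between
  \<open>exp (- a' * T)\<close> and \<open>q = exp (- a * T)\<close> pays for the linearization
  error, so \<open>F T\<close> contracts distances to \<open>x0\<close> by \<open>q\<close> near
  \<open>x0\<close> and can be iterated.\<close>

lemma F_local_decay:
  assumes a: "a > 0" "kappa_plus_op A < - a"
  obtains C \<delta> where "C > 0" "\<delta> > 0"
    "\<And>t x. t \<ge> 0 \<Longrightarrow> x \<in> ball x0 \<delta> \<Longrightarrow> norm (F t x - x0) \<le> C * exp (- a * t) * norm (x - x0)"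
proof -
  obtain a' where "a < a'" "a' < - kappa_plus_op A"
    using a(2) dense[of a "- kappa_plus_op A"] by auto
  then have a': "kappa_plus_op A < - a'" "a < a'" by auto
  have "\<forall>\<^sub>F T in at_top. norm (op_exp T A) \<le> exp (- a' * T) \<and> T > 0"
    using kappa_plus_op_bound[OF A_stable a'(1)] eventually_gt_at_top[of 0] by eventually_elim simp
  then obtain T where T: "norm (op_exp T A) \<le> exp (- a' * T)" "T > 0"
    using eventually_happens'[OF trivial_limit_at_top_linorder] by blast
  define q where "q = exp (- a * T)"
  have q: "0 < q" "q \<le> 1" using a T by (auto simp: q_def)
  have "q - exp (- a' * T) > 0" using a' T by (simp add: q_def)
  then obtain \<delta>1 where \<delta>1: "\<delta>1 > 0" "\<And>x. x \<in> ball x0 \<delta>1 \<Longrightarrow>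
      norm (F T x - x0 - op_exp T A (x - x0)) \<le> (q - exp (- a' * T)) * norm (x - x0)"
    using F_linearization[OF T(2)] by metis
  obtain r C where r: "r > 0" "C > 0" "ball x0 r \<subseteq> D"
    and C: "\<And>t x. t \<ge> 0 \<Longrightarrow> x \<in> ball x0 r \<Longrightarrow> norm (F t x - x0) \<le> C * norm (x - x0)"
    using F_lipschitz_at_fixed by metis
  define \<delta> where "\<delta> = min \<delta>1 r"
  have step: "norm (F T x - x0) \<le> q * norm (x - x0)" if "x \<in> ball x0 \<delta>" for x
  proof -
    have "norm (F T x - x0) \<le> norm (F T x - x0 - op_exp T A (x - x0)) + norm (op_exp T A (x - x0))"
      using norm_triangle_ineq[of "F T x - x0 - op_exp T A (x - x0)" "op_exp T A (x - x0)"] by simp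
    also have "\<dots> \<le> (q - exp (- a' * T)) * norm (x - x0) + exp (- a' * T) * norm (x - x0)"
    proof (rule add_mono)
      show "norm (op_exp T A (x - x0)) \<le> exp (- a' * T) * norm (x - x0)"
        using norm_blinfun[of "op_exp T A" "x - x0"] mult_right_mono[OF T(1) norm_ge_zero[of "x - x0"]]
        by linarith
    qed (use \<delta>1(2) that in \<open>simp add: \<delta>_def\<close>)
    finally show ?thesis by (simp add: algebra_simps)
  qed
  have iter: "F (real n * T) x \<in> ball x0 \<delta> \<and> norm (F (real n * T) x - x0) \<le> q ^ n * norm (x - x0)"
    if x: "x \<in> ball x0 \<delta>" for n x
  proof (induction n)
    case 0
    have "x \<in> D" using x r by (auto simp: \<delta>_def)
    then show ?case using x F_0 by simp
  next
    case (Suc n)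
    have xD: "x \<in> D" using x r by (auto simp: \<delta>_def)
    have eq: "F (real (Suc n) * T) x = F T (F (real n * T) x)"
      using F_semigroup[of T "real n * T" x] T(2) xD by (simp add: algebra_simps)
    have 1: "norm (F (real (Suc n) * T) x - x0) \<le> q * norm (F (real n * T) x - x0)"
      unfolding eq using Suc by (intro step) blast
    also have "\<dots> \<le> q * (q ^ n * norm (x - x0))" using Suc q by (intro mult_left_mono) auto
    finally have 2: "norm (F (real (Suc n) * T) x - x0) \<le> q ^ Suc n * norm (x - x0)"
      by (simp add: mult.assoc)
    have "q * norm (F (real n * T) x - x0) \<le> norm (F (real n * T) x - x0)"
      using q by (simp add: mult_left_le_one_le)
    with 1 have "norm (F (real (Suc n) * T) x - x0) \<le> norm (F (real n * T) x - x0)" by (rule order_trans)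
    moreover have "norm (F (real n * T) x - x0) < \<delta>"
      using Suc by (simp add: dist_norm norm_minus_commute)
    ultimately have "F (real (Suc n) * T) x \<in> ball x0 \<delta>"
      by (simp add: dist_norm norm_minus_commute[of x0])
    with 2 show ?case by blast
  qed
  have "norm (F t x - x0) \<le> C * exp (a * T) * exp (- a * t) * norm (x - x0)"
    if t: "t \<ge> 0" and x: "x \<in> ball x0 \<delta>" for t x
  proof -
    \<comment> \<open>The time left after \<open>n\<close> full periods is covered by the Lipschitz
      constant \<open>C\<close>; rounding down costs at most the factor
      \<open>exp (a * T)\<close>.\<close>
    define n where "n = nat \<lfloor>t / T\<rfloor>"
    have n: "real n * T \<le> t" "t < (real n + 1) * T"
    proof -
      have "0 \<le> t / T" using t T(2) by simp
      then have "real n \<le> t / T" "t / T < real n + 1" unfolding n_def by linarith+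
      then show "real n * T \<le> t" "t < (real n + 1) * T" using T(2) by (simp_all add: field_simps)
    qed
    have xD: "x \<in> D" using x r by (auto simp: \<delta>_def)
    have qn: "q ^ n \<le> exp (a * T) * exp (- a * t)"
    proof -
      have "a * t \<le> a * ((real n + 1) * T)" using n(2) a(1) by (intro mult_left_mono) auto
      then have "real n * (- a * T) \<le> a * T + - a * t" by (simp add: algebra_simps)
      moreover have "q ^ n = exp (real n * (- a * T))"
        unfolding q_def by (rule exp_of_nat_mult[symmetric])
      ultimately show ?thesis by (simp add: exp_add[symmetric])
    qed
    have "F t x = F (t - real n * T) (F (real n * T) x)"
      using F_semigroup[of "t - real n * T" "real n * T" x] n T(2) xD by simp
    then have "norm (F t x - x0) \<le> C * norm (F (real n * T) x - x0)"
      using C[of "t - real n * T" "F (real n * T) x"] iter[OF x, of n] n by (simp add: \<delta>_def)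
    also have "\<dots> \<le> C * (q ^ n * norm (x - x0))" using iter[OF x] r by (intro mult_left_mono) auto
    also have "\<dots> \<le> C * (exp (a * T) * exp (- a * t) * norm (x - x0))"
      using qn r by (intro mult_left_mono mult_right_mono) auto
    finally show ?thesis by (simp add: mult.assoc)
  qed
  moreover have "C * exp (a * T) > 0" "\<delta> > 0" using r \<delta>1 by (auto simp: \<delta>_def)
  ultimately show ?thesis using that by blast
qed

text \<open>Uniform convergence brings all of \<open>rball R\<close> into the region of local decay
  at a common time \<open>T\<close>; the delay enters only the constant.\<close>

lemma F_decay:
  assumes a: "a > 0" "kappa_plus_op A < - a"
  obtains C T where "C > 0" "T \<ge> 0"
    "\<And>t x. t \<ge> T \<Longrightarrow> x \<in> rball R \<Longrightarrow> norm (F t x - x0) \<le> C * exp (- a * t)"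
proof -
  obtain C \<delta> where C: "C > 0" "\<delta> > 0" and decay:
    "\<And>t x. t \<ge> 0 \<Longrightarrow> x \<in> ball x0 \<delta> \<Longrightarrow> norm (F t x - x0) \<le> C * exp (- a * t) * norm (x - x0)"
    using F_local_decay[OF a] by metis
  have "\<forall>\<^sub>F t in at_top. (\<forall>x\<in>rball R. dist (F t x) x0 < \<delta>) \<and> t \<ge> 0"
    using F_conv[OF rball_strictly_inside] C(2) eventually_ge_at_top[of 0]
    unfolding uniform_limit_iff by (intro eventually_conj) auto
  then obtain T where T: "\<And>x. x \<in> rball R \<Longrightarrow> dist (F T x) x0 < \<delta>" "T \<ge> 0"
    using eventually_happens'[OF trivial_limit_at_top_linorder] by blast
  have "norm (F t x - x0) \<le> C * exp (a * T) * \<delta> * exp (- a * t)" if t: "t \<ge> T" and x: "x \<in> rball R" for t x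
  proof -
    have xD: "x \<in> D" using x rball_subset by blast
    have "F t x = F (t - T) (F T x)" using F_semigroup[of "t - T" T x] t T(2) xD by simp
    then have "norm (F t x - x0) \<le> C * exp (- a * (t - T)) * norm (F T x - x0)"
      using decay[of "t - T" "F T x"] T(1)[OF x] t by (simp add: dist_commute)
    also have "\<dots> \<le> C * exp (- a * (t - T)) * \<delta>"
      using T(1)[OF x] C by (intro mult_left_mono) (auto simp: dist_norm)
    also have "exp (- a * (t - T)) = exp (a * T) * exp (- a * t)"
      by (simp add: exp_add[symmetric] algebra_simps)
    finally show ?thesis by (simp add: mult_ac)
  qed
  moreover have "C * exp (a * T) * \<delta> > 0" using C by simp
  ultimately show ?thesis using that T(2) by blast
qed

end

section \<open>Linear equations with integrable coefficients\<close>

definition two_sided_unit :: "'b::monoid_mult \<Rightarrow> bool" where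
  "two_sided_unit a \<longleftrightarrow> (\<exists>b. a * b = 1 \<and> b * a = 1)"

lemma two_sided_unit_mult:
  assumes "two_sided_unit a" "two_sided_unit b" shows "two_sided_unit (a * b)"
proof -
  obtain a' b' where "a * a' = 1" "a' * a = 1" "b * b' = 1" "b' * b = 1"
    using assms unfolding two_sided_unit_def by blast
  then have "(a * b) * (b' * a') = 1" "(b' * a') * (a * b) = 1"
    by (metis mult.assoc mult_1_right)+
  then show ?thesis unfolding two_sided_unit_def by blast
qed

lemma two_sided_unit_exp: "two_sided_unit (exp (a :: 'b::{real_normed_algebra_1,banach}))"
  unfolding two_sided_unit_def using exp_minus_inverse[of a] exp_minus_inverse[of "- a"] by auto

text \<open>The Neumann series of \<open>1 - a\<close> is the inverse.\<close>

lemma two_sided_unit_near_1: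
  fixes a :: "'b::{real_normed_algebra_1,banach}"
  assumes a: "norm (a - 1) < 1" shows "two_sided_unit a"
proof -
  define c where "c = 1 - a"
  have summ: "summable (\<lambda>n. c ^ n)"
    using a by (intro complete_algebra_summable_geometric) (simp add: c_def norm_minus_commute)
  define S where "S = (\<Sum>n. c ^ n)"
  have S: "S = 1 + (\<Sum>n. c ^ Suc n)"
    unfolding S_def using suminf_split_head[OF summ] by simp
  have "S = 1 + c * S" unfolding S_def
    using S suminf_mult[OF summ, of c] by (simp add: S_def)
  moreover have "S = 1 + S * c" unfolding S_def
    using S suminf_mult2[OF summ, of c] by (simp add: S_def power_commutes)
  ultimately have "a * S = 1" "S * a = 1" by (simp_all add: c_def algebra_simps)
  then show ?thesis unfolding two_sided_unit_def by blast
qed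

lemma holo_on_mult_left:
  fixes h :: "'a::complex_normed_vector \<Rightarrow> 'b::complex_normed_algebra_1"
  assumes "holo_on D h" shows "holo_on D (\<lambda>x. a * h x)"
  unfolding holo_on_def
proof
  fix x assume "x \<in> D"
  then obtain L where "(h has_derivative L) (at x)" "\<And>c v. L (c *\<^sub>C v) = c *\<^sub>C L v"
    using assms unfolding holo_on_def by blast
  then show "\<exists>L. ((\<lambda>x. a * h x) has_derivative L) (at x) \<and> (\<forall>c v. L (c *\<^sub>C v) = c *\<^sub>C L v)"
    by (intro exI[of _ "\<lambda>v. a * L v"]) (auto intro: has_derivative_mult_right simp: scaleC_right_commute)
qed

lemma exp_decay_tendsto_0:
  fixes \<eta> :: real
  assumes \<eta>: "\<eta> > 0" shows "((\<lambda>t. G * exp (- \<eta> * t)) \<longlongrightarrow> 0) at_top"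
proof -
  have "filterlim (\<lambda>t. - \<eta> * t) at_bot at_top"
    by (rule filterlim_tendsto_neg_mult_at_bot[OF tendsto_const _ filterlim_ident]) (use \<eta> in simp)
  then have "((\<lambda>t. exp (- \<eta> * t)) \<longlongrightarrow> 0) at_top"
    by (rule filterlim_compose[OF exp_at_bot])
  then show ?thesis by (rule tendsto_mult_right_zero)
qed

text \<open>The coefficient has finite total mass on \<open>{T..}\<close>, at most 1/2 by
  \<open>small\<close>. This bounds \<open>y\<close>, then makes \<open>y'\<close> integrable with
  an exponentially small tail.\<close>

lemma integrable_linear_ode_limit:
  fixes y :: "real \<Rightarrow> 'b::banach"
  assumes der: "\<And>t. t \<ge> T \<Longrightarrow> (y has_vector_derivative y' t) (at t within {T..})"
    and bnd: "\<And>t. t \<ge> T \<Longrightarrow> norm (y' t) \<le> c * exp (- \<eta> * t) * norm (y t)"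
    and c: "c \<ge> 0" and \<eta>: "\<eta> > 0" and small: "c / \<eta> * exp (- \<eta> * T) \<le> 1 / 2"
  obtains l where "(y \<longlongrightarrow> l) at_top"
    "\<And>t. t \<ge> T \<Longrightarrow> norm (y t - l) \<le> 2 * (c / \<eta>) * norm (y T) * exp (- \<eta> * t)"
proof -
  have cont: "continuous_on {T..} y"
    by (rule continuous_on_vector_derivative[of _ y y']) (use der in auto)
  have incr: "norm (y t - y s) \<le> m * (c / \<eta>) * (exp (- \<eta> * s) - exp (- \<eta> * t))"
    if st: "T \<le> s" "s \<le> t" and m: "\<And>u. s \<le> u \<Longrightarrow> u \<le> t \<Longrightarrow> norm (y u) \<le> m" for s t m
  proof (cases "s = t")
    case False
    \<comment> \<open>An antiderivative of \<open>m * c * exp (- \<eta> * u)\<close>, the comparison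
      function in the mean value inequality.\<close>
    define \<phi> where "\<phi> u = - (m * (c / \<eta>)) * exp (- \<eta> * u)" for u
    have "norm (y t - y s) \<le> \<phi> t - \<phi> s"
    proof (rule differentiable_bound_general)
      show "s < t" using st False by simp
      show "continuous_on {s..t} y" by (rule continuous_on_subset[OF cont]) (use st in auto)
      show "continuous_on {s..t} \<phi>" unfolding \<phi>_def by (intro continuous_intros)
      fix u assume u: "s < u" "u < t"
      then have "u \<in> interior {T..}" using st by simp
      then show "(y has_vector_derivative y' u) (at u)"
        using der[of u] u st at_within_interior by (metis less_imp_le order_trans)
      show "(\<phi> has_vector_derivative m * c * exp (- \<eta> * u)) (at u)"
        unfolding \<phi>_def using \<eta> by (auto intro!: derivative_eq_intros
          simp: has_real_derivative_iff_has_vector_derivative[symmetric])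
      have "norm (y' u) \<le> c * exp (- \<eta> * u) * norm (y u)" using bnd u st by simp
      also have "\<dots> \<le> c * exp (- \<eta> * u) * m" using m u c by (intro mult_left_mono) auto
      finally show "norm (y' u) \<le> m * c * exp (- \<eta> * u)" by (simp add: mult_ac)
    qed
    then show ?thesis by (simp add: \<phi>_def algebra_simps)
  qed simp
  have bounded: "norm (y t) \<le> 2 * norm (y T)" if t: "t \<ge> T" for t
  proof -
    have "continuous_on {T..t} (\<lambda>u. norm (y u))"
      by (intro continuous_on_norm continuous_on_subset[OF cont]) auto
    \<comment> \<open>At a maximum point \<open>s\<close> of the norm, the increment from
      \<open>T\<close> to \<open>s\<close> is at most half of \<open>norm (y s)\<close> and can be
      absorbed.\<close>
    then obtain s where s: "s \<in> {T..t}" "\<And>u. u \<in> {T..t} \<Longrightarrow> norm (y u) \<le> norm (y s)"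
      using continuous_attains_sup[of "{T..t}" "\<lambda>u. norm (y u)"] t by auto
    have "norm (y s - y T) \<le> norm (y s) * (c / \<eta>) * (exp (- \<eta> * T) - exp (- \<eta> * s))"
      using s by (intro incr) auto
    also have "\<dots> \<le> norm (y s) * (c / \<eta>) * exp (- \<eta> * T)"
      using c \<eta> by (intro mult_left_mono) auto
    also have "\<dots> = norm (y s) * (c / \<eta> * exp (- \<eta> * T))" by simp
    also have "\<dots> \<le> norm (y s) * (1 / 2)" by (intro mult_left_mono small) simp
    finally have "norm (y s) \<le> 2 * norm (y T)"
      using norm_triangle_ineq2[of "y s" "y T"] by simp
    moreover have "norm (y t) \<le> norm (y s)" using s(2) t by simp
    ultimately show ?thesis by linarith
  qed
  define G where "G = 2 * (c / \<eta>) * norm (y T)"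
  have G: "G \<ge> 0" using c \<eta> by (simp add: G_def)
  have tail: "norm (y t - y s) \<le> G * exp (- \<eta> * s)" if "T \<le> s" "s \<le> t" for s t
  proof -
    have "norm (y t - y s) \<le> 2 * norm (y T) * (c / \<eta>) * (exp (- \<eta> * s) - exp (- \<eta> * t))"
      using that bounded by (intro incr) auto
    also have "\<dots> \<le> 2 * norm (y T) * (c / \<eta>) * exp (- \<eta> * s)"
      using c \<eta> by (intro mult_left_mono) auto
    finally show ?thesis by (simp add: G_def mult_ac)
  qed
  have exp0: "((\<lambda>t. G * exp (- \<eta> * t)) \<longlongrightarrow> 0) at_top"
    using \<eta> by (rule exp_decay_tendsto_0)
  have "Cauchy (\<lambda>n. y (T + real n))"
  proof (rule metric_CauchyI)
    fix e :: real assume "e > 0"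
    with exp0 have "\<forall>\<^sub>F t in at_top. G * exp (- \<eta> * t) < e" by (rule order_tendstoD)
    then obtain N where N: "\<And>t. t \<ge> N \<Longrightarrow> G * exp (- \<eta> * t) < e"
      unfolding eventually_at_top_linorder by blast
    obtain k where k: "real k \<ge> N - T" using real_arch_simple by blast
    have "dist (y (T + real m)) (y (T + real n)) < e" if "k \<le> n" "n \<le> m" for m n
    proof -
      have "real k \<le> real n" using that by simp
      then show ?thesis using tail[of "T + real n" "T + real m"] N[of "T + real n"] that k
        unfolding dist_norm by fastforce
    qed
    then show "\<exists>M. \<forall>m\<ge>M. \<forall>n\<ge>M. dist (y (T + real m)) (y (T + real n)) < e"
      by (metis dist_commute linear)
  qed
  then obtain l where l: "(\<lambda>n. y (T + real n)) \<longlonglongrightarrow> l"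
    using Cauchy_convergent_iff convergent_def by blast
  have rate: "norm (y t - l) \<le> G * exp (- \<eta> * t)" if t: "t \<ge> T" for t
  proof (rule tendsto_upperbound)
    show "(\<lambda>n. norm (y t - y (T + real n))) \<longlonglongrightarrow> norm (y t - l)"
      by (intro tendsto_intros l)
    obtain k where "real k \<ge> t - T" using real_arch_simple by blast
    then have "t \<le> T + real n" if "n \<ge> k" for n
      using of_nat_mono[OF that, where 'a = real] by linarith
    then show "\<forall>\<^sub>F n in sequentially. norm (y t - y (T + real n)) \<le> G * exp (- \<eta> * t)"
      unfolding eventually_sequentially using tail t by (metis norm_minus_commute)
  qed simp
  have "((\<lambda>t. y t - l) \<longlongrightarrow> 0) at_top"
  proof (rule Lim_null_comparison[OF _ exp0])
    show "\<forall>\<^sub>F t in at_top. norm (y t - l) \<le> G * exp (- \<eta> * t)"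
      using eventually_ge_at_top[of T] by eventually_elim (rule rate)
  qed
  then have "(y \<longlongrightarrow> l) at_top" by (simp add: LIM_zero_iff)
  with rate show ?thesis unfolding G_def by (rule that[rotated])
qed

section \<open>Semicocycles\<close>

locale generated_semicocycle = generated_semigroup D \<rho> F x0 f A
  for D :: "'a::{complex_normed_vector,banach} set" and \<rho> F x0 f A +
  fixes \<Gamma> :: "real \<Rightarrow> 'a \<Rightarrow> 'b::{complex_normed_algebra_1,banach}"
    and B :: "'a \<Rightarrow> 'b" and ell :: real
  assumes \<Gamma>_holo: "\<And>t. t \<ge> 0 \<Longrightarrow> holo_on D (\<Gamma> t)"
    and \<Gamma>_cocycle: "\<And>t s x. t \<ge> 0 \<Longrightarrow> s \<ge> 0 \<Longrightarrow> x \<in> D \<Longrightarrow>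
                        \<Gamma> t (F s x) * \<Gamma> s x = \<Gamma> (t + s) x"
    and \<Gamma>_Tcont: "\<And>t0 S. t0 \<ge> 0 \<Longrightarrow> strictly_inside D S \<Longrightarrow>
                        uniform_limit S \<Gamma> (\<Gamma> t0) (at t0 within {0..})"
    and B_holo: "holo_on D B"
    and \<Gamma>_gen: "\<And>x t. x \<in> D \<Longrightarrow> t \<ge> 0 \<Longrightarrow>
                   ((\<lambda>s. \<Gamma> s x) has_vector_derivative (B (F t x) * \<Gamma> t x)) (at t within {0..})"
    and \<Gamma>_init: "\<And>x. x \<in> D \<Longrightarrow> \<Gamma> 0 x = 1"
    and ell_def: "ell = (kappa_plus (B x0) - kappa_minus (B x0)) / \<bar>kappa_plus_op A\<bar>"
    and B_flat: "((\<lambda>x. norm (B x - B x0) / (norm (x - x0) powr ell)) \<longlongrightarrow> 0) (at x0)"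
begin

section \<open>The conjugated semicocycle and its limit\<close>

definition Y :: "real \<Rightarrow> 'a \<Rightarrow> 'b" where
  "Y t x = exp (- (t *\<^sub>R B x0)) * \<Gamma> t x"

text \<open>This is \<open>K Y\<close>: the right factor \<open>exp (t *\<^sub>R B x0)\<close> of
  \<open>K\<close> has been merged with \<open>Y\<close> into \<open>\<Gamma>\<close>.\<close>

definition Y' :: "real \<Rightarrow> 'a \<Rightarrow> 'b" where
  "Y' t x = exp (- (t *\<^sub>R B x0)) * (B (F t x) - B x0) * \<Gamma> t x"

definition M :: "'a \<Rightarrow> 'b" where
  "M x = Lim at_top (\<lambda>t. Y t x)"

lemma Y_holo: "t \<ge> 0 \<Longrightarrow> holo_on D (Y t)"
  unfolding Y_def by (intro holo_on_mult_left \<Gamma>_holo)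

lemma \<Gamma>_eq_Y: "\<Gamma> t x = exp (t *\<^sub>R B x0) * Y t x"
  by (simp add: Y_def mult.assoc[symmetric] exp_minus_inverse)

lemma Y_has_vector_derivative:
  assumes "x \<in> D" "t \<ge> 0"
  shows "((\<lambda>s. Y s x) has_vector_derivative Y' t x) (at t within {0..})"
proof -
  have "((\<lambda>s. exp (- (s *\<^sub>R B x0))) has_vector_derivative - (exp (- (t *\<^sub>R B x0)) * B x0)) (at t within {0..})"
    using exp_scaleR_has_vector_derivative_right[of "- B x0" t "{0..}"] by simp
  from has_vector_derivative_mult[OF this \<Gamma>_gen[OF assms]]
  show ?thesis unfolding Y_def Y'_def by (simp add: algebra_simps)
qed

text \<open>Schwarz' lemma needs a bounded map. The radius is chosen by continuity so that
  \<open>B - B x0\<close> is bounded by 1, and \<open>K\<close> is the corresponding power of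
  \<open>1 / r\<close>.\<close>

lemma B_near_x0:
  obtains r K where "r > 0" "K > 0"
    "\<And>y. y \<in> ball x0 r \<Longrightarrow> norm (B y - B x0) \<le> K * norm (y - x0) ^ (nat \<lfloor>ell\<rfloor> + 1)"
proof -
  have "isCont B x0" using holo_on_imp_isCont[OF B_holo x0_in] .
  then obtain r1 where r1: "r1 > 0" "\<And>y. dist y x0 < r1 \<Longrightarrow> dist (B y) (B x0) < 1"
    unfolding continuous_at_eps_delta using zero_less_one by blast
  obtain r2 where r2: "r2 > 0" "ball x0 r2 \<subseteq> D" using D_open x0_in openE by blast
  define r where "r = min r1 r2"
  have r: "r > 0" "ball x0 r \<subseteq> D" using r1 r2 by (auto simp: r_def)
  have "norm (B y - B x0) \<le> 1 / r ^ (nat \<lfloor>ell\<rfloor> + 1) * norm (y - x0) ^ (nat \<lfloor>ell\<rfloor> + 1)"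
    if y: "y \<in> ball x0 r" for y
  proof -
    have "norm (B y - B x0) \<le> 1 * (norm (y - x0) / r) ^ (nat \<lfloor>ell\<rfloor> + 1)"
      using holo_on_subset[OF B_holo r(2)] _ B_flat y
    proof (rule holo_on_flat_bound)
      show "norm (B z - B x0) \<le> 1" if "z \<in> ball x0 r" for z
        using r1(2)[of z] that by (simp add: r_def dist_commute dist_norm[symmetric])
    qed
    then show ?thesis by (simp add: power_divide)
  qed
  moreover have "1 / r ^ (nat \<lfloor>ell\<rfloor> + 1) > 0" using r by simp
  ultimately show ?thesis using r(1) that by blast
qed

text \<open>The exponents add up: \<open>- kappa_minus + e\<close> and \<open>kappa_plus + e\<close>
  from the two exponentials, and \<open>- m * a\<close> from the order of vanishing of
  \<open>B - B x0\<close> along the decaying orbit. The sum is \<open>- \<eta>\<close>.\<close>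

lemma Y'_bound:
  obtains c \<eta> T where "c > 0" "\<eta> > 0" "T \<ge> 0"
    "\<And>t x. t \<ge> T \<Longrightarrow> x \<in> rball R \<Longrightarrow> norm (Y' t x) \<le> c * exp (- \<eta> * t) * norm (Y t x)"
proof -
  define m where "m = nat \<lfloor>ell\<rfloor> + 1"
  define ka where "ka = - kappa_plus_op A"
  define g where "g = kappa_plus (B x0) - kappa_minus (B x0)"
  have ka: "ka > 0" using A_stable by (simp add: ka_def)
  have m: "real m > ell" "real m > 0" unfolding m_def by linarith+
  have "ell = g / ka" using A_stable by (simp add: ell_def ka_def g_def)
  \<comment> \<open>Here the definition of \<open>ell\<close> enters: \<open>m > ell\<close> becomes
    \<open>m * ka > g\<close>.\<close>
  then have "g = ell * ka" using ka by simp
  then have gap: "real m * ka - g > 0" using mult_strict_right_mono[OF m(1) ka] by simp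
  \<comment> \<open>The bound \<open>ka / 2\<close> keeps the rate \<open>a\<close> positive. Since
    \<open>\<eta>\<close> will be \<open>(m * ka - g) - (m + 2) * e\<close>, the denominator
    \<open>m + 3\<close> leaves at least \<open>e\<close> over.\<close>
  define e where "e = min (ka / 2) ((real m * ka - g) / (real m + 3))"
  have e: "e > 0" "e < ka" using ka gap by (auto simp: e_def)
  have "e \<le> (real m * ka - g) / (real m + 3)" by (simp add: e_def)
  then have "e * (real m + 3) \<le> real m * ka - g" by (simp add: pos_le_divide_eq)
  then have e2: "g + 2 * e - real m * (ka - e) < 0" using e(1) by (simp add: algebra_simps)
  define a where "a = ka - e"
  have a: "a > 0" "kappa_plus_op A < - a" using e by (auto simp: a_def ka_def)
  define \<eta> where "\<eta> = real m * a - g - 2 * e"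
  have \<eta>: "\<eta> > 0" using e2 by (simp add: \<eta>_def a_def)
  obtain C T1 where C: "C > 0"
    "\<And>t x. t \<ge> T1 \<Longrightarrow> x \<in> rball R \<Longrightarrow> norm (F t x - x0) \<le> C * exp (- a * t)"
    using F_decay[OF a, of R] by metis
  obtain r K where r: "r > 0" and K: "K > 0"
    "\<And>y. y \<in> ball x0 r \<Longrightarrow> norm (B y - B x0) \<le> K * norm (y - x0) ^ m"
    using B_near_x0 unfolding m_def by metis
  have "\<forall>\<^sub>F t in at_top. norm (exp (t *\<^sub>R B x0)) \<le> exp ((kappa_plus (B x0) + e) * t)"
    by (rule kappa_plus_bound) (use e in simp)
  moreover have "\<forall>\<^sub>F t in at_top. norm (exp (- (t *\<^sub>R B x0))) \<le> exp ((- kappa_minus (B x0) + e) * t)"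
    by (rule kappa_minus_bound) (use e in simp)
  moreover have "\<forall>\<^sub>F t in at_top. \<forall>x\<in>rball R. dist (F t x) x0 < r"
    using F_conv[OF rball_strictly_inside] r unfolding uniform_limit_iff by blast
  ultimately have "\<forall>\<^sub>F t in at_top. norm (exp (t *\<^sub>R B x0)) \<le> exp ((kappa_plus (B x0) + e) * t) \<and>
      norm (exp (- (t *\<^sub>R B x0))) \<le> exp ((- kappa_minus (B x0) + e) * t) \<and>
      (\<forall>x\<in>rball R. dist (F t x) x0 < r) \<and> t \<ge> T1"
    using eventually_ge_at_top[of T1] by eventually_elim blast
  then obtain T2 where T2: "\<And>t. t \<ge> T2 \<Longrightarrow> norm (exp (t *\<^sub>R B x0)) \<le> exp ((kappa_plus (B x0) + e) * t) \<and>
      norm (exp (- (t *\<^sub>R B x0))) \<le> exp ((- kappa_minus (B x0) + e) * t) \<and>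
      (\<forall>x\<in>rball R. dist (F t x) x0 < r) \<and> t \<ge> T1"
    unfolding eventually_at_top_linorder by blast
  have "norm (Y' t x) \<le> K * C ^ m * exp (- \<eta> * t) * norm (Y t x)" if t: "t \<ge> max T2 0" and x: "x \<in> rball R" for t x
  proof -
    have 1: "norm (exp (t *\<^sub>R B x0)) \<le> exp ((kappa_plus (B x0) + e) * t)"
      and 2: "norm (exp (- (t *\<^sub>R B x0))) \<le> exp ((- kappa_minus (B x0) + e) * t)"
      and near: "F t x \<in> ball x0 r" and tT: "t \<ge> T1"
      using T2[of t] t x by (auto simp: dist_commute)
    have "norm (B (F t x) - B x0) \<le> K * norm (F t x - x0) ^ m" by (rule K(2)[OF near])
    also have "\<dots> \<le> K * (C * exp (- a * t)) ^ m"
      using C(2)[OF tT x] K(1) by (intro mult_left_mono power_mono) auto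
    also have "\<dots> = K * C ^ m * exp (- (real m * a) * t)"
      by (simp add: power_mult_distrib exp_of_nat_mult[symmetric] mult.assoc)
    finally have 3: "norm (B (F t x) - B x0) \<le> K * C ^ m * exp (- (real m * a) * t)" .
    \<comment> \<open>Writing \<open>\<Gamma>\<close> as \<open>exp (t *\<^sub>R B x0) * Y\<close>
      brings back \<open>norm (Y t x)\<close>, as a linear differential inequality requires.\<close>
    have "norm (Y' t x) \<le> norm (exp (- (t *\<^sub>R B x0)) * (B (F t x) - B x0)) * norm (\<Gamma> t x)"
      unfolding Y'_def by (rule norm_mult_ineq)
    also have "\<dots> \<le> norm (exp (- (t *\<^sub>R B x0))) * norm (B (F t x) - B x0) *
        (norm (exp (t *\<^sub>R B x0)) * norm (Y t x))"
      unfolding \<Gamma>_eq_Y[of t x] by (rule mult_mono[OF norm_mult_ineq norm_mult_ineq]) simp_all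
    also have "\<dots> \<le> exp ((- kappa_minus (B x0) + e) * t) * (K * C ^ m * exp (- (real m * a) * t)) *
        (exp ((kappa_plus (B x0) + e) * t) * norm (Y t x))"
      using K(1) C(1) by (intro mult_mono 1 2 3 mult_nonneg_nonneg order_refl) auto
    also have "\<dots> = K * C ^ m * (exp ((- kappa_minus (B x0) + e) * t) * exp (- (real m * a) * t) *
        exp ((kappa_plus (B x0) + e) * t)) * norm (Y t x)"
      by (simp only: mult_ac)
    also have "exp ((- kappa_minus (B x0) + e) * t) * exp (- (real m * a) * t) *
        exp ((kappa_plus (B x0) + e) * t) = exp (- \<eta> * t)"
      by (simp add: exp_add[symmetric] \<eta>_def g_def algebra_simps)
    finally show ?thesis .
  qed
  moreover have "K * C ^ m > 0" using K(1) C(1) by simp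
  ultimately show ?thesis using \<eta> that[of "K * C ^ m" \<eta> "max T2 0"] by auto
qed

text \<open>The constants depend only on the invariant set \<open>rball R\<close>. The starting
  value \<open>Y T y\<close> is the only quantity that varies with \<open>y\<close>, and continuity
  of \<open>Y T\<close> bounds it near \<open>x\<close>, so the rate is uniform on a ball.\<close>

lemma M_local_rate:
  assumes x: "x \<in> D"
  obtains \<delta> G \<eta> T where "\<delta> > 0" "ball x \<delta> \<subseteq> D" "\<eta> > 0"
    "\<And>y. y \<in> ball x \<delta> \<Longrightarrow> ((\<lambda>t. Y t y) \<longlongrightarrow> M y) at_top"
    "\<And>y t. y \<in> ball x \<delta> \<Longrightarrow> t \<ge> T \<Longrightarrow> norm (Y t y - M y) \<le> G * exp (- \<eta> * t)"
proof -
  obtain \<delta>1 R where \<delta>1: "\<delta>1 > 0" "ball x \<delta>1 \<subseteq> rball R" using ball_in_rball[OF x] .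
  obtain c \<eta> T1 where c: "c > 0" "\<eta> > 0" "T1 \<ge> 0"
    and bnd: "\<And>t x. t \<ge> T1 \<Longrightarrow> x \<in> rball R \<Longrightarrow> norm (Y' t x) \<le> c * exp (- \<eta> * t) * norm (Y t x)"
    using Y'_bound[of R] by metis
  have "\<forall>\<^sub>F t in at_top. c / \<eta> * exp (- \<eta> * t) < 1 / 2"
    using exp_decay_tendsto_0[OF c(2)] by (rule order_tendstoD) simp
  then have "\<forall>\<^sub>F t in at_top. c / \<eta> * exp (- \<eta> * t) < 1 / 2 \<and> t \<ge> T1"
    using eventually_ge_at_top[of T1] by eventually_elim simp
  then obtain T where T: "c / \<eta> * exp (- \<eta> * T) < 1 / 2" "T \<ge> T1"
    using eventually_happens'[OF trivial_limit_at_top_linorder] by blast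
  have T0: "T \<ge> 0" using T c by linarith
  have "isCont (Y T) x" using holo_on_imp_isCont[OF Y_holo[OF T0] x] .
  then obtain \<delta>2 where \<delta>2: "\<delta>2 > 0" "\<And>y. dist y x < \<delta>2 \<Longrightarrow> dist (Y T y) (Y T x) < 1"
    unfolding continuous_at_eps_delta using zero_less_one by blast
  define \<delta> where "\<delta> = min \<delta>1 \<delta>2"
  define G where "G = 2 * (c / \<eta>) * (norm (Y T x) + 1)"
  have sub: "ball x \<delta> \<subseteq> rball R" using \<delta>1 by (auto simp: \<delta>_def)
  have main: "((\<lambda>t. Y t y) \<longlongrightarrow> M y) at_top \<and> (\<forall>t\<ge>T. norm (Y t y - M y) \<le> G * exp (- \<eta> * t))"
    if y: "y \<in> ball x \<delta>" for y
  proof -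
    have yR: "y \<in> rball R" using y sub by blast
    then have yD: "y \<in> D" using rball_subset by blast
    obtain l where l: "((\<lambda>t. Y t y) \<longlongrightarrow> l) at_top"
      "\<And>t. t \<ge> T \<Longrightarrow> norm (Y t y - l) \<le> 2 * (c / \<eta>) * norm (Y T y) * exp (- \<eta> * t)"
    proof (rule integrable_linear_ode_limit)
      show "((\<lambda>t. Y t y) has_vector_derivative Y' t y) (at t within {T..})" if "t \<ge> T" for t
        using Y_has_vector_derivative[OF yD, of t] that T0
        by (intro has_vector_derivative_within_subset[of _ _ t "{0..}" "{T..}"]) auto
      show "norm (Y' t y) \<le> c * exp (- \<eta> * t) * norm (Y t y)" if "t \<ge> T" for t
        using bnd[OF _ yR] that T(2) by simp
    qed (use c T in auto)
    have M: "M y = l" unfolding M_def by (rule tendsto_Lim[OF trivial_limit_at_top_linorder l(1)])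
    have "dist (Y T y) (Y T x) < 1" using \<delta>2(2)[of y] y by (simp add: \<delta>_def dist_commute)
    then have "norm (Y T y) \<le> norm (Y T x) + 1"
      using norm_triangle_ineq2[of "Y T y" "Y T x"] by (simp add: dist_norm)
    then have "2 * (c / \<eta>) * norm (Y T y) * exp (- \<eta> * t) \<le> G * exp (- \<eta> * t)" for t
      unfolding G_def using c by (intro mult_right_mono mult_left_mono) auto
    then show ?thesis using l unfolding M by (meson order_trans)
  qed
  show ?thesis
  proof (rule that)
    show "\<delta> > 0" using \<delta>1 \<delta>2 by (simp add: \<delta>_def)
    show "ball x \<delta> \<subseteq> D" using sub rball_subset by blast
  qed (use main c(2) in auto)
qed

lemma Y_tendsto_M: assumes "x \<in> D" shows "((\<lambda>t. Y t x) \<longlongrightarrow> M x) at_top"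
  by (rule M_local_rate[OF assms]) (simp add: centre_in_ball[symmetric] del: centre_in_ball)

lemma M_holo: "holo_on D M"
proof (rule holo_on_uniform_limit)
  show "holo_on D (Y (real n))" for n by (rule Y_holo) simp
  fix x assume "x \<in> D"
  then obtain \<delta> G \<eta> T where \<delta>: "\<delta> > 0" "ball x \<delta> \<subseteq> D" and \<eta>: "\<eta> > 0" and
    rate: "\<And>y t. y \<in> ball x \<delta> \<Longrightarrow> t \<ge> T \<Longrightarrow> norm (Y t y - M y) \<le> G * exp (- \<eta> * t)"
    by (rule M_local_rate) blast
  have "uniform_limit (ball x \<delta>) (\<lambda>n. Y (real n)) M sequentially"
    unfolding uniform_limit_iff
  proof (intro allI impI)
    fix e :: real assume "e > 0"
    with exp_decay_tendsto_0[OF \<eta>] have "\<forall>\<^sub>F t in at_top. G * exp (- \<eta> * t) < e"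
      by (rule order_tendstoD)
    then have "\<forall>\<^sub>F t in at_top. \<forall>y\<in>ball x \<delta>. dist (Y t y) (M y) < e"
      using eventually_ge_at_top[of T]
    proof eventually_elim
      case (elim t)
      then show ?case using rate by (auto simp only: dist_norm intro: le_less_trans)
    qed
    then show "\<forall>\<^sub>F n in sequentially. \<forall>y\<in>ball x \<delta>. dist (Y (real n) y) (M y) < e"
      using filterlim_real_sequentially by (rule eventually_compose_filterlim)
  qed
  with \<delta> show "\<exists>\<delta>>0. ball x \<delta> \<subseteq> D \<and> uniform_limit (ball x \<delta>) (\<lambda>n. Y (real n)) M sequentially" by blast
qed

lemma M_cocycle:
  assumes x: "x \<in> D" and t: "t \<ge> 0"
  shows "M x = exp (- (t *\<^sub>R B x0)) * M (F t x) * \<Gamma> t x"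
proof -
  have eq: "Y (s + t) x = exp (- (t *\<^sub>R B x0)) * Y s (F t x) * \<Gamma> t x" if s: "s \<ge> 0" for s
  proof -
    \<comment> \<open>The factor belonging to \<open>t\<close> goes in front, so that
      \<open>exp (- (s *\<^sub>R B x0))\<close> meets \<open>\<Gamma> s (F t x)\<close> and forms
      \<open>Y s (F t x)\<close>.\<close>
    have "exp (- ((s + t) *\<^sub>R B x0)) = exp (- (t *\<^sub>R B x0)) * exp (- (s *\<^sub>R B x0))"
    proof -
      have "exp (- (t *\<^sub>R B x0)) * exp (- (s *\<^sub>R B x0)) = exp (- (t *\<^sub>R B x0) + - (s *\<^sub>R B x0))"
        by (rule exp_add_commuting[symmetric]) simp
      also have "- (t *\<^sub>R B x0) + - (s *\<^sub>R B x0) = - ((s + t) *\<^sub>R B x0)"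
        by (simp add: algebra_simps)
      finally show ?thesis ..
    qed
    then show ?thesis using \<Gamma>_cocycle[OF s t x] by (simp add: Y_def mult.assoc)
  qed
  have 1: "((\<lambda>s. Y (s + t) x) \<longlongrightarrow> M x) at_top"
    using filterlim_compose[OF Y_tendsto_M[OF x]
        filterlim_tendsto_add_at_top[OF tendsto_const filterlim_ident, of t]]
    by (simp add: add.commute)
  have 2: "((\<lambda>s. exp (- (t *\<^sub>R B x0)) * Y s (F t x) * \<Gamma> t x) \<longlongrightarrow>
      exp (- (t *\<^sub>R B x0)) * M (F t x) * \<Gamma> t x) at_top"
    by (intro tendsto_intros Y_tendsto_M F_in x t)
  have 3: "\<forall>\<^sub>F s in at_top. exp (- (t *\<^sub>R B x0)) * Y s (F t x) * \<Gamma> t x = Y (s + t) x"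
    using eventually_ge_at_top[of 0] by eventually_elim (simp add: eq)
  show ?thesis
    by (rule tendsto_unique[OF trivial_limit_at_top_linorder 1 Lim_transform_eventually[OF 2 3]])
qed

text \<open>Along the constant orbit of \<open>x0\<close> the coefficient
  \<open>B (F t x0) - B x0\<close> vanishes, so \<open>Y\<close> keeps its initial value 1.\<close>

lemma M_x0: "M x0 = 1"
proof -
  have const: "Y t x0 = 1" if t: "t \<ge> 0" for t
  proof -
    have "((\<lambda>s. Y s x0) has_derivative (\<lambda>h. 0)) (at s within {0..})" if "s \<in> {0..}" for s
      using Y_has_vector_derivative[OF x0_in, of s] that F_fixed[of s]
      by (simp add: Y'_def has_vector_derivative_def)
    then obtain c where "\<And>s. s \<in> {0..} \<Longrightarrow> Y s x0 = c"
      using has_derivative_zero_constant[of "{0..}" "\<lambda>s. Y s x0"] by auto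
    then have "Y t x0 = Y 0 x0" using t by simp
    then show ?thesis by (simp add: Y_def \<Gamma>_init[OF x0_in])
  qed
  have "\<forall>\<^sub>F t in at_top. 1 = Y t x0"
    using eventually_ge_at_top[of 0] by eventually_elim (simp add: const)
  then have "((\<lambda>t. Y t x0) \<longlongrightarrow> 1) at_top"
    by (rule Lim_transform_eventually[OF tendsto_const])
  then show ?thesis
    using tendsto_unique[OF trivial_limit_at_top_linorder Y_tendsto_M[OF x0_in]] by blast
qed

text \<open>\<open>T\<close>-continuity at time 0 puts \<open>\<Gamma> h\<close> within distance 1
  of the unit, uniformly on \<open>rball R\<close>, for all small \<open>h\<close>. The orbit stays
  in that set, so the cocycle law writes \<open>\<Gamma> t x\<close> as a product of such
  factors.\<close>

lemma \<Gamma>_unit: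
  assumes x: "x \<in> D" and t: "t \<ge> 0" shows "two_sided_unit (\<Gamma> t x)"
proof -
  obtain \<delta> R where "\<delta> > 0" "ball x \<delta> \<subseteq> rball R" using ball_in_rball[OF x] .
  then have xR: "x \<in> rball R" by auto
  have "\<forall>\<^sub>F h in at 0 within {0..}. \<forall>y\<in>rball R. dist (\<Gamma> h y) (\<Gamma> 0 y) < 1"
    using \<Gamma>_Tcont[OF order_refl rball_strictly_inside] zero_less_one unfolding uniform_limit_iff by blast
  then obtain d where d: "d > 0"
    "\<And>h y. 0 < h \<Longrightarrow> h < d \<Longrightarrow> y \<in> rball R \<Longrightarrow> dist (\<Gamma> h y) (\<Gamma> 0 y) < 1"
    unfolding eventually_at by force
  have small: "two_sided_unit (\<Gamma> h y)" if h: "0 \<le> h" "h < d" and y: "y \<in> rball R" for h y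
  proof -
    have "\<Gamma> 0 y = 1" using \<Gamma>_init y rball_subset by blast
    moreover have "dist (\<Gamma> h y) (\<Gamma> 0 y) < 1" using d(2)[of h y] h y by (cases "h = 0") auto
    ultimately show ?thesis by (intro two_sided_unit_near_1) (simp add: dist_norm)
  qed
  \<comment> \<open>Strictness puts the step \<open>t / n\<close> below \<open>d\<close>, and also
    gives \<open>n > 0\<close> when \<open>t = 0\<close>.\<close>
  obtain n where n: "t / d < real n" using reals_Archimedean2 by blast
  have "n > 0" using n t d by (metis divide_nonneg_pos gr0I not_less of_nat_0)
  define h where "h = t / real n"
  have h: "0 \<le> h" "h < d" "real n * h = t"
    using t n d(1) \<open>n > 0\<close> by (auto simp: h_def field_simps)
  have "two_sided_unit (\<Gamma> (real k * h) x)" for k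
  proof (induction k)
    case 0
    then show ?case using small[of 0 x] d(1) xR by simp
  next
    case (Suc k)
    have "\<Gamma> (real (Suc k) * h) x = \<Gamma> h (F (real k * h) x) * \<Gamma> (real k * h) x"
      using \<Gamma>_cocycle[of h "real k * h" x] h(1) x by (simp add: algebra_simps)
    then show ?case using small[OF h(1,2) F_rball[OF _ xR]] h(1) Suc
      by (simp add: two_sided_unit_mult)
  qed
  then show ?thesis using h(3) by metis
qed

lemma M_unit:
  assumes x: "x \<in> D" shows "two_sided_unit (M x)"
proof -
  have "isCont M x0" using holo_on_imp_isCont[OF M_holo x0_in] .
  then obtain d where d: "d > 0" "\<And>y. dist y x0 < d \<Longrightarrow> dist (M y) (M x0) < 1"
    unfolding continuous_at_eps_delta using zero_less_one by blast
  obtain \<delta> where \<delta>: "\<delta> > 0" "strictly_inside D (ball x \<delta>)" using ball_strictly_inside[OF x] .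
  have "((\<lambda>t. F t x) \<longlongrightarrow> x0) at_top"
    using tendsto_uniform_limitI[OF F_conv[OF \<delta>(2)], of x] \<delta>(1) by simp
  then have "\<forall>\<^sub>F t in at_top. dist (F t x) x0 < d" using d(1) by (rule tendstoD)
  then have "\<forall>\<^sub>F t in at_top. dist (F t x) x0 < d \<and> t \<ge> 0"
    using eventually_ge_at_top[of 0] by eventually_elim simp
  then obtain t where t: "dist (F t x) x0 < d" "t \<ge> 0"
    using eventually_happens'[OF trivial_limit_at_top_linorder] by blast
  have "two_sided_unit (M (F t x))"
    using d(2)[OF t(1)] by (intro two_sided_unit_near_1) (simp add: M_x0 dist_norm)
  then show ?thesis
    unfolding M_cocycle[OF x t(2)] by (intro two_sided_unit_mult two_sided_unit_exp \<Gamma>_unit x t(2))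
qed

lemma linearization_exists:
  "\<exists>M N. holo_on D M \<and>
     (\<forall>x\<in>D. N x * M x = 1 \<and> M x * N x = 1) \<and>
     (\<forall>x\<in>D. ((\<lambda>t. exp (- (t *\<^sub>R B x0)) * \<Gamma> t x) \<longlongrightarrow> M x) at_top) \<and>
     (\<forall>t\<ge>0. \<forall>x\<in>D. \<Gamma> t x = N (F t x) * exp (t *\<^sub>R B x0) * M x)"
proof -
  have "\<forall>x\<in>D. \<exists>b. b * M x = 1 \<and> M x * b = 1"
    using M_unit unfolding two_sided_unit_def by blast
  then obtain N where N: "\<And>x. x \<in> D \<Longrightarrow> N x * M x = 1" "\<And>x. x \<in> D \<Longrightarrow> M x * N x = 1"
    unfolding bchoice_iff by blast
  have "\<Gamma> t x = N (F t x) * exp (t *\<^sub>R B x0) * M x" if t: "t \<ge> 0" and x: "x \<in> D" for t x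
  proof -
    have "N (F t x) * exp (t *\<^sub>R B x0) * M x =
        N (F t x) * (exp (t *\<^sub>R B x0) * exp (- (t *\<^sub>R B x0))) * M (F t x) * \<Gamma> t x"
      unfolding M_cocycle[OF x t] by (simp only: mult.assoc)
    also have "\<dots> = \<Gamma> t x" by (simp add: exp_minus_inverse N(1)[OF F_in[OF t x]])
    finally show ?thesis ..
  qed
  with M_holo N Y_tendsto_M show ?thesis
    unfolding Y_def by (intro exI[of _ M] exI[of _ N] conjI ballI allI impI) simp_all
qed

end

theorem theorem4p5:
  fixes D :: "'a::{complex_normed_vector,banach} set"
    and \<rho> :: "'a \<Rightarrow> 'a \<Rightarrow> real"
    and F :: "real \<Rightarrow> 'a \<Rightarrow> 'a"
    and f :: "'a \<Rightarrow> 'a"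
    and x0 :: 'a
    and A :: "'a \<Rightarrow>\<^sub>L 'a"
    and \<Gamma> :: "real \<Rightarrow> 'a \<Rightarrow> 'b::{complex_normed_algebra_1,banach}"
    and B :: "'a \<Rightarrow> 'b"
    and B0 :: 'b
    and ell :: real
  assumes D_open: "open D" and D_conn: "connected D" and D_ne: "D \<noteq> {}"
    and D_bdd: "bounded D"
    and hyp: "hyperbolic_metric D \<rho>"
    \<comment> \<open>semigroup of holomorphic self-maps\<close>
    and F_holo: "\<And>t. t \<ge> 0 \<Longrightarrow> holo_on D (F t)"
    and F_self: "\<And>t. t \<ge> 0 \<Longrightarrow> F t ` D \<subseteq> D"
    and F_semigroup: "\<And>t s x. t \<ge> 0 \<Longrightarrow> s \<ge> 0 \<Longrightarrow> x \<in> D \<Longrightarrow> F (t + s) x = F t (F s x)"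
    and F_cont0: "\<And>x. x \<in> D \<Longrightarrow> ((\<lambda>t. F t x) \<longlongrightarrow> x) (at_right 0)"
    \<comment> \<open>condition (*)\<close>
    and x0_in: "x0 \<in> D"
    and F_conv: "\<And>S. strictly_inside D S \<Longrightarrow> uniform_limit S F (\<lambda>_. x0) at_top"
    and f_holo: "holo_on D f"
    and f_gen: "\<And>S. strictly_inside D S \<Longrightarrow>
                  uniform_limit S (\<lambda>t x. (1 / t) *\<^sub>R (F t x - x)) f (at_right 0)"
    and A_deriv: "(f has_derivative blinfun_apply A) (at x0)"
    and A_stable: "kappa_plus_op A < 0"
    \<comment> \<open>T-continuous semicocycle generated by B\<close>
    and \<Gamma>_holo: "\<And>t. t \<ge> 0 \<Longrightarrow> holo_on D (\<Gamma> t)"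
    and \<Gamma>_cocycle: "\<And>t s x. t \<ge> 0 \<Longrightarrow> s \<ge> 0 \<Longrightarrow> x \<in> D \<Longrightarrow>
                        \<Gamma> t (F s x) * \<Gamma> s x = \<Gamma> (t + s) x"
    and \<Gamma>_cont0: "\<And>x. x \<in> D \<Longrightarrow> ((\<lambda>t. \<Gamma> t x) \<longlongrightarrow> 1) (at_right 0)"
    and \<Gamma>_Tcont: "\<And>t0 S. t0 \<ge> 0 \<Longrightarrow> strictly_inside D S \<Longrightarrow>
                        uniform_limit S \<Gamma> (\<Gamma> t0) (at t0 within {0..})"
    and B_holo: "holo_on D B"
    and \<Gamma>_gen: "\<And>x t. x \<in> D \<Longrightarrow> t \<ge> 0 \<Longrightarrow>
                   ((\<lambda>s. \<Gamma> s x) has_vector_derivative (B (F t x) * \<Gamma> t x)) (at t within {0..})"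
    and \<Gamma>_init: "\<And>x. x \<in> D \<Longrightarrow> \<Gamma> 0 x = 1"
    and B0_def: "B0 = B x0"
    and ell_def: "ell = (kappa_plus B0 - kappa_minus B0) / \<bar>kappa_plus_op A\<bar>"
    and B_flat: "((\<lambda>x. norm (B x - B0) / (norm (x - x0) powr ell)) \<longlongrightarrow> 0) (at x0)"
  shows "\<exists>M N. holo_on D M \<and>
           (\<forall>x\<in>D. N x * M x = 1 \<and> M x * N x = 1) \<and>
           (\<forall>x\<in>D. ((\<lambda>t. exp (- (t *\<^sub>R B0)) * \<Gamma> t x) \<longlongrightarrow> M x) at_top) \<and>
           (\<forall>t\<ge>0. \<forall>x\<in>D. \<Gamma> t x = N (F t x) * exp (t *\<^sub>R B0) * M x)"
proof -
  interpret generated_semicocycle D \<rho> F x0 f A \<Gamma> B ell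
    by unfold_locales
      (fact D_open D_bdd hyp F_holo F_self F_semigroup F_cont0 x0_in F_conv f_holo f_gen A_deriv
        A_stable \<Gamma>_holo \<Gamma>_cocycle \<Gamma>_Tcont B_holo \<Gamma>_gen \<Gamma>_init
        ell_def[unfolded B0_def] B_flat[unfolded B0_def])+
  show ?thesis unfolding B0_def by (rule linearization_exists)
qed

end
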